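(* Let $\mathfrak{c}$ be an ample interrupted constellation. Then $\mathfrak{c}$ has no induced subgraph isomorphic to any of the following. (i) An ample $q$-zigzagged $\left(3q+6,\,6\binom{q+2}{3}\right)$-constellation, for $q\in\mathbb{N}$. (ii) A subdivision of $T_7$ or the line graph of a subdivision of $T_7$. (iii) A subdivision of $W_{6\times6}$ or the line graph of a subdivision of $W_{6\times 6}$.
   Context: $\mathbb{N}$ is the set of positive integers. Graphs are finite, with no loops and no parallel edges. A path in a graph $G$ is an induced subgraph of $G$ that is a path (a single vertex counts as a path); the interior $R^*$ of a path $R$ is $R$ minus its ends. $T_r$ is the full binary tree of radius $r$ (on $2^{r+1}-1$ vertices). A subdivision of $H$ is obtained by replacing each edge $e=uv$ by a path $P_e$ of length at least 1 from $u$ to $v$, the interiors being pairwise disjoint and with no edges between them. Wall: $W_{r\times r}$ denotes the $r$-by-$r$ hexagonal grid, also known as the $r$-by-$r$ wall. Concretely, for $r\ge 2$: take the vertex set $\{(i,j):1\le i\le r,\ 1\le j\le 2r\}$, with edges $(i,j)(i,j+1)$ for $1\le i\le r$, $1\le j\le 2r-1$, and $(i,j)(i+1,j)$ for $1\le i\le r-1$, $1\le j\le 2r$ with $i+j$ even, and delete the vertices of degree one. Constellation: a graph $\mathfrak{c}$ together with a stable set $S_{\mathfrak{c}}$ such that every component of $\mathfrak{c}\setminus S_{\mathfrak{c}}$ is a path, and each $x\in S_{\mathfrak{c}}$ has at least one neighbor in each component of $\mathfrak{c}\setminus S_{\mathfrak{c}}$. $\mathcal{L}_{\mathfrak{c}}$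 is the set of components of $\mathfrak{c}\setminus S_{\mathfrak{c}}$. An $(s,l)$-constellation has $|S_{\mathfrak{c}}|=s$ and $|\mathcal{L}_{\mathfrak{c}}|=l$. A $\mathfrak{c}$-route is a path $R$ in $\mathfrak{c}$ with two distinct ends, both in $S_{\mathfrak{c}}$, and with $R^*\subseteq V(L)$ for some $L\in\mathcal{L}_{\mathfrak{c}}$. $\mathfrak{c}$ is ample if there is no $\mathfrak{c}$-route of length at most 2, i.e. no two vertices in $S_{\mathfrak{c}}$ have a common neighbor in $\mathfrak{c}\setminus S_{\mathfrak{c}}$. $\mathfrak{c}$ is interrupted if there is a linear order $\preccurlyeq$ on $S_{\mathfrak{c}}$ such that for all $x,y,z\in S_{\mathfrak{c}}$ with $x\prec y\prec z$ and every $\mathfrak{c}$-route $R$ from $x$ to $y$, the vertex $z$ has a neighbor in $R$. For $q\in\mathbb{N}$, $\mathfrak{c}$ is $q$-zigzagged if there is a linear order $\preccurlyeq$ on $S_{\mathfrak{c}}$ such that for all $x,y\in S_{\mathfrak{c}}$ with $x\prec y$ and every $\mathfrak{c}$-route $R$ from $x$ to $y$, there are fewer than $q$ vertices $z\in S_{\mathfrak{c}}$ where $x\prec z\prec y$ and $z$ has no neighbor in $R$. *)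

theory Defs
  imports Complex_Main
begin
text \<open>
  Edges are two-element sets of vertices. With this representation the vertex set of a line
  graph is literally the edge set of the original graph.
\<close>

record 'a graph =
  verts :: "'a set"
  edges :: "'a set set"

definition simple_graph :: "'a graph \<Rightarrow> bool" where
  "simple_graph G \<longleftrightarrow>
     finite (verts G) \<and> (\<forall>e\<in>edges G. e \<subseteq> verts G \<and> card e = 2)"

definition adj :: "'a graph \<Rightarrow> 'a \<Rightarrow> 'a \<Rightarrow> bool" where
  "adj G u v \<longleftrightarrow> {u, v} \<in> edges G"

definition degree :: "'a graph \<Rightarrow> 'a \<Rightarrow> nat" where
  "degree G v = card {u \<in> verts G. adj G v u}"

definition induced :: "'a graph \<Rightarrow> 'a set \<Rightarrow> 'a graph" where
  "induced G X = \<lparr>verts = verts G \<inter> X, edges = {e \<in> edges G. e \<subseteq> X}\<rparr>"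

definition delete_verts :: "'a graph \<Rightarrow> 'a set \<Rightarrow> 'a graph" where
  "delete_verts G X = induced G (verts G - X)"

definition induced_subgraph :: "'a graph \<Rightarrow> 'a graph \<Rightarrow> bool" where
  "induced_subgraph H G \<longleftrightarrow> (\<exists>X\<subseteq>verts G. H = induced G X)"

definition isomorphic :: "'a graph \<Rightarrow> 'b graph \<Rightarrow> bool" where
  "isomorphic G H \<longleftrightarrow>
     (\<exists>f. bij_betw f (verts G) (verts H) \<and>
          (\<forall>u\<in>verts G. \<forall>v\<in>verts G. adj G u v \<longleftrightarrow> adj H (f u) (f v)))"

definition contains_induced :: "'a graph \<Rightarrow> 'b graph \<Rightarrow> bool" where
  "contains_induced G H \<longleftrightarrow> (\<exists>K. induced_subgraph K G \<and> isomorphic K H)"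

definition stable :: "'a graph \<Rightarrow> 'a set \<Rightarrow> bool" where
  "stable G X \<longleftrightarrow> X \<subseteq> verts G \<and> (\<forall>u\<in>X. \<forall>v\<in>X. \<not> adj G u v)"

definition connectivity :: "'a graph \<Rightarrow> ('a \<times> 'a) set" where
  "connectivity G =
     {(u, v). u \<in> verts G \<and> v \<in> verts G \<and> (u, v) \<in> {(a, b). adj G a b}\<^sup>*}"

definition components :: "'a graph \<Rightarrow> 'a graph set" where
  "components G = induced G ` (verts G // connectivity G)"

definition line_graph :: "'a graph \<Rightarrow> 'a set graph" where
  "line_graph G =
     \<lparr>verts = edges G,
      edges = {{e, f} | e f. e \<in> edges G \<and> f \<in> edges G \<and> e \<noteq> f \<and> e \<inter> f \<noteq> {}}\<rparr>"

definition path_graph :: "'a list \<Rightarrow> 'a graph" where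
  "path_graph xs =
     \<lparr>verts = set xs, edges = {{xs ! i, xs ! Suc i} | i. Suc i < length xs}\<rparr>"

text \<open>The list of vertices is non-empty, so a single vertex is a path (with equal ends).\<close>

definition path_between :: "'a graph \<Rightarrow> 'a \<Rightarrow> 'a \<Rightarrow> bool" where
  "path_between P x y \<longleftrightarrow>
     (\<exists>xs. xs \<noteq> [] \<and> distinct xs \<and> hd xs = x \<and> last xs = y \<and> P = path_graph xs)"

definition is_path :: "'a graph \<Rightarrow> bool" where
  "is_path P \<longleftrightarrow> (\<exists>x y. path_between P x y)"

definition path_length :: "'a graph \<Rightarrow> nat" where
  "path_length P = card (edges P)"

text \<open>
  In a subdivision \<open>G\<close> of \<open>H\<close>, the vertices of \<open>H\<close> are
  identified with vertices of \<open>G\<close> via \<open>b\<close>. Every edge of \<open>G\<close>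
  belongs to one of the paths \<open>P e\<close>, so there are no edges between the interiors of
  different paths.
\<close>

definition subdivision_of :: "'b graph \<Rightarrow> 'a graph \<Rightarrow> bool" where
  "subdivision_of G H \<longleftrightarrow>
     (\<exists>b P. inj_on b (verts H) \<and>
        (\<forall>u v. {u, v} \<in> edges H \<longrightarrow>
           path_between (P {u, v}) (b u) (b v) \<and> path_length (P {u, v}) \<ge> 1) \<and>
        (\<forall>e\<in>edges H. (verts (P e) - b ` e) \<inter> b ` verts H = {}) \<and>
        (\<forall>e\<in>edges H. \<forall>f\<in>edges H. e \<noteq> f \<longrightarrow>
           (verts (P e) - b ` e) \<inter> (verts (P f) - b ` f) = {}) \<and>
        verts G = b ` verts H \<union> (\<Union>e\<in>edges H. verts (P e)) \<and>
        edges G = (\<Union>e\<in>edges H. edges (P e)))"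

text \<open>
  A vertex of the full binary tree of radius \<open>r\<close> is the sequence of left/right
  choices leading to it, most recent choice first; the root is the empty list.
\<close>

definition binary_tree :: "nat \<Rightarrow> bool list graph" where
  "binary_tree r =
     \<lparr>verts = {xs. length xs \<le> r}, edges = {{xs, c # xs} | xs c. length xs < r}\<rparr>"

definition uncropped_wall :: "nat \<Rightarrow> (nat \<times> nat) graph" where
  "uncropped_wall r =
     \<lparr>verts = {1..r} \<times> {1..2 * r},
      edges = {{(i, j), (i, j + 1)} | i j. 1 \<le> i \<and> i \<le> r \<and> 1 \<le> j \<and> j < 2 * r}
            \<union> {{(i, j), (i + 1, j)} | i j. 1 \<le> i \<and> i < r \<and> 1 \<le> j \<and> j \<le> 2 * r \<and> even (i + j)}\<rparr>"

definition wall :: "nat \<Rightarrow> (nat \<times> nat) graph" where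
  "wall r = delete_verts (uncropped_wall r)
              {v \<in> verts (uncropped_wall r). degree (uncropped_wall r) v = 1}"

text \<open>A constellation is given by its graph \<open>c\<close> and its stable set \<open>S\<close>.\<close>

definition constellation :: "'a graph \<Rightarrow> 'a set \<Rightarrow> bool" where
  "constellation c S \<longleftrightarrow>
     simple_graph c \<and> stable c S \<and>
     (\<forall>L\<in>components (delete_verts c S).
        is_path L \<and> (\<forall>x\<in>S. \<exists>v\<in>verts L. adj c x v))"

definition sized_constellation :: "nat \<Rightarrow> nat \<Rightarrow> 'a graph \<Rightarrow> 'a set \<Rightarrow> bool" where
  "sized_constellation s l c S \<longleftrightarrow>
     constellation c S \<and> card S = s \<and> card (components (delete_verts c S)) = l"

text \<open>Paths in a graph are, by convention, induced subgraphs.\<close>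

definition route :: "'a graph \<Rightarrow> 'a set \<Rightarrow> 'a graph \<Rightarrow> 'a \<Rightarrow> 'a \<Rightarrow> bool" where
  "route c S R x y \<longleftrightarrow>
     induced_subgraph R c \<and> path_between R x y \<and> x \<noteq> y \<and> x \<in> S \<and> y \<in> S \<and>
     (\<exists>L\<in>components (delete_verts c S). verts R - {x, y} \<subseteq> verts L)"

definition ample :: "'a graph \<Rightarrow> 'a set \<Rightarrow> bool" where
  "ample c S \<longleftrightarrow> \<not> (\<exists>R x y. route c S R x y \<and> path_length R \<le> 2)"

definition has_neighbor_in :: "'a graph \<Rightarrow> 'a \<Rightarrow> 'a graph \<Rightarrow> bool" where
  "has_neighbor_in c z R \<longleftrightarrow> (\<exists>v\<in>verts R. adj c z v)"

text \<open>
  Linear orders are the reflexive relations of the library, so the strict order is obtained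
  by adding an inequality.
\<close>

definition interrupted :: "'a graph \<Rightarrow> 'a set \<Rightarrow> bool" where
  "interrupted c S \<longleftrightarrow>
     (\<exists>r. linear_order_on S r \<and>
        (\<forall>x\<in>S. \<forall>y\<in>S. \<forall>z\<in>S.
           (x, y) \<in> r \<and> x \<noteq> y \<and> (y, z) \<in> r \<and> y \<noteq> z \<longrightarrow>
           (\<forall>R. route c S R x y \<longrightarrow> has_neighbor_in c z R)))"

definition zigzagged :: "nat \<Rightarrow> 'a graph \<Rightarrow> 'a set \<Rightarrow> bool" where
  "zigzagged q c S \<longleftrightarrow>
     (\<exists>r. linear_order_on S r \<and>
        (\<forall>x\<in>S. \<forall>y\<in>S. (x, y) \<in> r \<and> x \<noteq> y \<longrightarrow>
           (\<forall>R. route c S R x y \<longrightarrow>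
              card {z \<in> S. (x, z) \<in> r \<and> x \<noteq> z \<and> (z, y) \<in> r \<and> z \<noteq> y \<and>
                           \<not> has_neighbor_in c z R} < q)))"

end

theory Submission
  imports Defs
begin

text \<open>
  Let \<open>H\<close> be an induced subgraph of the ample interrupted constellation \<open>c\<close> with stable set
  \<open>S\<close>.  In a connected set of vertices that contains two vertices of \<open>S\<close>, a shortest path between
  two such vertices is a \<open>c\<close>-route.  Let \<open>k\<close> be the greatest vertex of \<open>S\<close> in \<open>H\<close> for the order
  that witnesses the interruption.  Every route in \<open>H\<close> between two smaller vertices contains a
  neighbor of \<open>k\<close>, so \<^emph>\<open>every connected set of vertices of \<open>H\<close> that avoids the closed
  neighborhood \<open>N[k]\<close> contains at most one vertex of \<open>S\<close>\<close> (\<open>interrupted_separator\<close>).  Moreover,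
  as \<open>c\<close> is ample, a vertex outside \<open>S\<close> has at most one neighbor in \<open>S\<close> and, because \<open>c\<close> minus
  \<open>S\<close> is a disjoint union of paths, at most two others; and every triangle meets \<open>S\<close>.
  These properties pass to \<open>H\<close> and are called \<open>separable\<close> below; they exclude all the graphs in
  question.

  \<^item> Subdivided trees and walls, and their line graphs.  A vertex of degree at least three, or in a
    triangle, has a vertex of \<open>S\<close> in its closed neighborhood.  As \<open>N[k]\<close> has at most five elements,
    one of any six disjoint connected sets avoids it.  If that set contains two such vertices with
    disjoint closed neighborhoods, then adding the two vertices of \<open>S\<close> near them gives a connected
    set that contradicts the property of \<open>k\<close> (\<open>not_separable_six_hub_pairs\<close>).  In the wall the
    six sets come from the six rows, and in the tree from paths through six vertices at depth three.

  \<^item> A zigzagged constellation \<open>d\<close> with stable set \<open>T\<close>.  The degrees force \<open>T \<subseteq> S\<close>.  If \<open>k\<close> is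
    not in \<open>T\<close>, it lies on one of the paths of \<open>d\<close>; another path together with two elements of \<open>T\<close>
    not adjacent to \<open>k\<close> is a connected set avoiding \<open>N[k]\<close>.  If \<open>k\<close> is in \<open>T\<close>, then each \<open>x\<close> in
    \<open>T\<close> is joined to \<open>k\<close> by a \<open>d\<close>-route that contains no neighbor of any third element of \<open>T\<close>
    (\<open>route_avoids\<close>).  So in the zigzag order fewer than \<open>q\<close> elements lie between \<open>x\<close> and \<open>k\<close>,
    whence \<open>T\<close> has at most \<open>2 * q + 1\<close> elements.
\<close>

section \<open>Linked vertex sets and routes\<close>

text \<open>\<open>linked G X\<close>: the subgraph of \<open>G\<close> induced on \<open>X\<close> is connected or empty.\<close>

definition linked :: "'a graph \<Rightarrow> 'a set \<Rightarrow> bool" where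
  "linked G X \<longleftrightarrow> (\<forall>x\<in>X. \<forall>y\<in>X. (x, y) \<in> {(a, b). a \<in> X \<and> b \<in> X \<and> adj G a b}\<^sup>*)"

lemma adj_sym: "adj G u v \<longleftrightarrow> adj G v u"
  by (simp add: adj_def insert_commute)

lemma linked_singleton: "linked G {x}"
  by (simp add: linked_def)

lemma linked_Un:
  assumes A: "linked G A" and B: "linked G B" and ab: "a \<in> A" "b \<in> B" "a = b \<or> adj G a b"
  shows "linked G (A \<union> B)"
proof -
  let ?r = "\<lambda>X. {(a, b). a \<in> X \<and> b \<in> X \<and> adj G a b}"
  have mono: "(?r A)\<^sup>* \<subseteq> (?r (A \<union> B))\<^sup>*" "(?r B)\<^sup>* \<subseteq> (?r (A \<union> B))\<^sup>*"
    by (rule rtrancl_mono; auto)+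
  have sym: "sym ((?r (A \<union> B))\<^sup>*)"
    by (rule sym_rtrancl) (auto simp: sym_def adj_sym)
  have bridge: "(a, b) \<in> (?r (A \<union> B))\<^sup>*"
    using ab by auto
  have toa: "(x, a) \<in> (?r (A \<union> B))\<^sup>*" if "x \<in> A \<union> B" for x
  proof (cases "x \<in> A")
    case True
    then show ?thesis using A ab(1) mono(1) unfolding linked_def by blast
  next
    case False
    then have "(x, b) \<in> (?r (A \<union> B))\<^sup>*"
      using that B ab(2) mono(2) unfolding linked_def by blast
    then show ?thesis using bridge sym by (meson rtrancl_trans symE)
  qed
  show ?thesis unfolding linked_def
    using toa sym by (meson rtrancl_trans symE)
qed

lemma linked_insert:
  assumes "linked G A" "a \<in> A" "adj G a x"
  shows "linked G (insert x A)"
  using linked_Un[OF assms(1) linked_singleton[of G x] assms(2), of x] assms(3) by auto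

lemma linked_walk: "successively (adj G) xs \<Longrightarrow> linked G (set xs)"
proof (induction xs rule: induct_list012)
  case (3 x y zs)
  then have "linked G (set (y # zs))" "adj G y x" by (auto simp: adj_sym)
  then show ?case using linked_insert[of G "set (y # zs)" y x] by simp
qed (auto simp: linked_def)

lemma linked_mono_edges:
  assumes "linked G X" "edges G \<subseteq> edges G'"
  shows "linked G' X"
proof -
  have "{(a, b). a \<in> X \<and> b \<in> X \<and> adj G a b}\<^sup>* \<subseteq> {(a, b). a \<in> X \<and> b \<in> X \<and> adj G' a b}\<^sup>*"
    by (rule rtrancl_mono) (use assms(2) in \<open>auto simp: adj_def\<close>)
  then show ?thesis using assms(1) unfolding linked_def by blast
qed

lemma linked_image:
  assumes "linked G X" and "\<And>u v. u \<in> X \<Longrightarrow> v \<in> X \<Longrightarrow> adj G u v \<Longrightarrow> adj G' (g u) (g v)"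
  shows "linked G' (g ` X)"
proof -
  have "(g x, g y) \<in> {(a, b). a \<in> g ` X \<and> b \<in> g ` X \<and> adj G' a b}\<^sup>*"
    if "(x, y) \<in> {(a, b). a \<in> X \<and> b \<in> X \<and> adj G a b}\<^sup>*" for x y
    using that
  proof (induction rule: rtrancl_induct)
    case (step y z)
    then show ?case using assms(2)[of y z] by (auto intro: rtrancl_into_rtrancl)
  qed simp
  then show ?thesis using assms(1) unfolding linked_def by blast
qed

lemma linked_walk_exists:
  assumes "linked G X" "x \<in> X" "y \<in> X"
  shows "\<exists>xs. xs \<noteq> [] \<and> hd xs = x \<and> last xs = y \<and> set xs \<subseteq> X \<and> successively (adj G) xs"
proof -
  have "(x, y) \<in> {(a, b). a \<in> X \<and> b \<in> X \<and> adj G a b}\<^sup>*"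
    using assms unfolding linked_def by blast
  then show ?thesis
  proof (induction rule: rtrancl_induct)
    case base
    then show ?case using assms(2) by (intro exI[of _ "[x]"]) simp
  next
    case (step y z)
    then obtain xs where "xs \<noteq> []" "hd xs = x" "last xs = y" "set xs \<subseteq> X"
      "successively (adj G) xs" by blast
    then show ?case using step(2)
      by (intro exI[of _ "xs @ [z]"]) (auto simp: successively_append_iff)
  qed
qed

lemma verts_path_graph [simp]: "verts (path_graph xs) = set xs"
  by (simp add: path_graph_def)

lemma edges_path_graph:
  "edges (path_graph xs) = (\<lambda>i. {xs ! i, xs ! Suc i}) ` {..<length xs - 1}"
proof -
  have "{..<length xs - 1} = {i. Suc i < length xs}" by auto
  then show ?thesis by (auto simp: path_graph_def)
qed

lemma path_graph_edgeI: "Suc i < length xs \<Longrightarrow> {xs ! i, xs ! Suc i} \<in> edges (path_graph xs)"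
  by (auto simp: path_graph_def)

lemma path_graph_edge_iff:
  assumes "distinct xs" "i < length xs" "j < length xs"
  shows "{xs ! i, xs ! j} \<in> edges (path_graph xs) \<longleftrightarrow> j = Suc i \<or> i = Suc j"
proof
  assume "{xs ! i, xs ! j} \<in> edges (path_graph xs)"
  then obtain k where k: "Suc k < length xs" "{xs ! i, xs ! j} = {xs ! k, xs ! Suc k}"
    by (auto simp: path_graph_def)
  then show "j = Suc i \<or> i = Suc j"
    using assms by (auto simp: doubleton_eq_iff nth_eq_iff_index_eq)
qed (use assms in \<open>auto simp: path_graph_def insert_commute\<close>)

lemma path_graph_walk: "successively (adj (path_graph xs)) xs"
  by (auto simp: successively_conv_nth adj_def path_graph_def)

lemma path_graph_rev: "path_graph (rev xs) = path_graph xs"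
proof -
  have sub: "edges (path_graph (rev ys)) \<subseteq> edges (path_graph ys)" for ys :: "'a list"
  proof
    fix e assume "e \<in> edges (path_graph (rev ys))"
    then obtain i where i: "Suc i < length ys" "e = {rev ys ! i, rev ys ! Suc i}"
      by (auto simp: path_graph_def)
    define j where "j = length ys - Suc (Suc i)"
    have "Suc j < length ys" "rev ys ! i = ys ! Suc j" "rev ys ! Suc i = ys ! j"
      using i(1) by (auto simp: j_def rev_nth Suc_diff_Suc)
    then show "e \<in> edges (path_graph ys)"
      using i(2) by (auto simp: path_graph_def insert_commute)
  qed
  have "edges (path_graph (rev xs)) = edges (path_graph xs)"
    using sub[of xs] sub[of "rev xs"] by auto
  then show ?thesis by (simp add: path_graph_def)
qed

lemma route_sym:
  assumes "route c S R x y"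
  shows "route c S R y x"
proof -
  have "path_between R y x"
    using assms unfolding route_def path_between_def
    by (metis distinct_rev hd_rev last_rev path_graph_rev rev_is_Nil_conv)
  then show ?thesis using assms unfolding route_def by (auto simp: insert_commute)
qed

lemma verts_delete [simp]: "verts (delete_verts G S) = verts G - S"
  by (auto simp: delete_verts_def induced_def)

lemma adj_delete: "adj (delete_verts G S) u v \<longleftrightarrow> adj G u v \<and> u \<in> verts G - S \<and> v \<in> verts G - S"
  by (auto simp: delete_verts_def induced_def adj_def)

lemma connectivity_equiv: "equiv (verts G) (connectivity G)"
proof -
  have "sym {(a, b). adj G a b}" by (auto simp: sym_def adj_sym)
  then have s: "sym ({(a, b). adj G a b}\<^sup>*)" by (rule sym_rtrancl)
  show ?thesis
    unfolding connectivity_def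
    by (rule equivI) (use s in \<open>auto simp: refl_on_def sym_def trans_def\<close>)
qed

lemma component_eq:
  assumes "L \<in> components G" "v \<in> verts L"
  shows "L = induced G (connectivity G `` {v})"
proof -
  obtain x where x: "x \<in> verts G" "L = induced G (connectivity G `` {x})"
    using assms(1) unfolding components_def quotient_def by blast
  then have "(x, v) \<in> connectivity G" using assms(2) by (auto simp: induced_def)
  then show ?thesis using x(2) equiv_class_eq[OF connectivity_equiv] by metis
qed

lemma component_exists:
  assumes "v \<in> verts G"
  shows "\<exists>L\<in>components G. v \<in> verts L \<and> L = induced G (connectivity G `` {v})"
proof -
  have "(v, v) \<in> connectivity G" using assms by (simp add: connectivity_def)
  then show ?thesis using assms
    by (intro bexI[of _ "induced G (connectivity G `` {v})"])
      (auto simp: components_def quotient_def induced_def)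
qed

lemma component_subset: "L \<in> components G \<Longrightarrow> verts L \<subseteq> verts G"
  by (auto simp: components_def induced_def)

lemma component_edges: "L \<in> components G \<Longrightarrow> edges L \<subseteq> edges G"
  by (auto simp: components_def induced_def)

lemma component_adj:
  assumes "L \<in> components G" "v \<in> verts L" "adj G v u" "u \<in> verts G"
  shows "u \<in> verts L" "adj L v u"
proof -
  have L: "L = induced G (connectivity G `` {v})" and v: "v \<in> verts G"
    using component_eq[OF assms(1,2)] component_subset assms(1,2) by blast+
  have "(v, v) \<in> connectivity G" "(v, u) \<in> connectivity G"
    using assms(3,4) v by (auto simp: connectivity_def)
  then show "u \<in> verts L" "adj L v u"
    using assms(3,4) by (subst L; simp add: induced_def adj_def)+
qed

lemma walk_shortcut:
  assumes w: "successively (adj G) xs" and ij: "i < j" "j < length xs"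
    and a: "adj G (xs ! i) (xs ! j)"
  shows "successively (adj G) (take (Suc i) xs @ drop j xs)"
proof -
  have 1: "successively (adj G) (take (Suc i) xs)" "successively (adj G) (drop j xs)"
    using w by (metis append_take_drop_id successively_append_iff)+
  have "last (take (Suc i) xs) = xs ! i" using ij by (simp add: take_Suc_conv_app_nth)
  moreover have "hd (drop j xs) = xs ! j" using ij by (simp add: hd_drop_conv_nth)
  ultimately show ?thesis using 1 a by (simp add: successively_append_iff)
qed

text \<open>Take a shortest walk inside \<open>X\<close> among all walks that join two distinct vertices of the
  stable set.  It has no chord and no interior vertex in the stable set, so it is a route.  Its ends
  need not be \<open>s\<close> and \<open>t\<close>.\<close>

lemma route_exists:
  assumes G: "simple_graph G" and S: "stable G S" and X: "X \<subseteq> verts G" "linked G X"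
    and st: "s \<in> X \<inter> S" "t \<in> X \<inter> S" "s \<noteq> t"
  shows "\<exists>R x y. route G S R x y \<and> verts R \<subseteq> X"
proof -
  define W where "W xs \<longleftrightarrow> xs \<noteq> [] \<and> hd xs \<in> S \<and> last xs \<in> S \<and> hd xs \<noteq> last xs \<and>
    set xs \<subseteq> X \<and> successively (adj G) xs" for xs
  have "\<exists>xs. W xs"
    using linked_walk_exists[OF X(2), of s t] st unfolding W_def by blast
  then obtain xs where xs: "W xs" and least: "\<And>ys. W ys \<Longrightarrow> length xs \<le> length ys"
    using ex_has_least_nat[of W _ length] by blast
  define n where "n = length xs"
  have ne: "xs \<noteq> []" and hS: "hd xs \<in> S" and lS: "last xs \<in> S" and hl: "hd xs \<noteq> last xs"
    and sX: "set xs \<subseteq> X" and sw: "successively (adj G) xs"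
    using xs by (auto simp: W_def)
  have short: False if "i < n" "j < n" "Suc i < j" "adj G (xs ! i) (xs ! j)" for i j
  proof -
    let ?ys = "take (Suc i) xs @ drop j xs"
    have "hd ?ys = hd xs" using that ne by (cases xs) auto
    moreover have "last ?ys = last xs" using that by (auto simp: n_def)
    moreover have "set ?ys \<subseteq> set xs" using set_take_subset[of "Suc i" xs] set_drop_subset[of j xs] by auto
    ultimately have "W ?ys"
      using walk_shortcut[OF sw, of i j] that ne hS lS hl sX by (auto simp: W_def n_def)
    then have "length xs \<le> length ?ys" by (rule least)
    then show False using that by (simp add: n_def)
  qed
  have dist: "distinct xs"
  proof (rule ccontr)
    assume "\<not> distinct xs"
    then obtain i j where ij: "i < j" "j < n" "xs ! i = xs ! j"
      by (metis distinct_conv_nth linorder_neqE_nat n_def)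
    \<comment> \<open>the part of the walk between the two occurrences can be dropped\<close>
    have jl: "Suc j < n"
    proof (rule ccontr)
      assume "\<not> Suc j < n"
      then have "j = n - 1" using ij by simp
      then have l: "xs ! i = last xs" using ij ne by (simp add: n_def last_conv_nth)
      let ?ys = "take (Suc i) xs"
      have "successively (adj G) ?ys" using sw by (metis append_take_drop_id successively_append_iff)
      moreover have "last ?ys = last xs" using ij l by (simp add: take_Suc_conv_app_nth n_def)
      moreover have "set ?ys \<subseteq> X" using sX set_take_subset by fast
      ultimately have "W ?ys" using ne hS lS hl by (auto simp: W_def)
      then show False using least[of ?ys] ij by (simp add: n_def)
    qed
    have "adj G (xs ! j) (xs ! Suc j)" using sw jl by (simp add: successively_conv_nth n_def)
    then show False using short[of i "Suc j"] ij jl by simp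
  qed
  have inner: "xs ! i \<notin> S" if "0 < i" "Suc i < n" for i
  proof
    assume iS: "xs ! i \<in> S"
    have "xs ! i \<noteq> hd xs" using dist that ne by (simp add: hd_conv_nth nth_eq_iff_index_eq n_def)
    moreover have "last (take (Suc i) xs) = xs ! i"
      using that by (simp add: take_Suc_conv_app_nth n_def)
    moreover have "successively (adj G) (take (Suc i) xs)"
      using sw by (metis append_take_drop_id successively_append_iff)
    ultimately have "W (take (Suc i) xs)"
      using iS ne hS sX set_take_subset[of "Suc i" xs] by (auto simp: W_def)
    then show False using least that by (fastforce simp: n_def)
  qed
  have consec: "adj G (xs ! i) (xs ! Suc i)" if "Suc i < n" for i
    using sw that by (simp add: successively_conv_nth n_def)
  have h0: "hd xs = xs ! 0" and ln: "last xs = xs ! (n - 1)"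
    using ne by (simp_all add: hd_conv_nth last_conv_nth n_def)
  have n3: "n \<ge> 3"
  proof (rule ccontr)
    assume "\<not> n \<ge> 3"
    moreover have "n \<noteq> 0" using ne by (simp add: n_def)
    moreover have "n \<noteq> 1" using hl h0 ln by auto
    ultimately have "n = 2" by simp
    then have "adj G (hd xs) (last xs)" using consec[of 0] h0 ln by simp
    then show False using S hS lS by (auto simp: stable_def)
  qed
  let ?R = "path_graph xs"
  have "induced_subgraph ?R G"
  proof -
    have "e \<in> edges ?R" if e: "e \<in> edges G" "e \<subseteq> set xs" for e
    proof -
      obtain u v where uv: "e = {u, v}" "u \<noteq> v"
        using G e(1) unfolding simple_graph_def by (meson card_2_iff)
      then obtain i j where ij: "i < n" "j < n" "u = xs ! i" "v = xs ! j"
        using e(2) by (auto simp: in_set_conv_nth n_def)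
      have "adj G (xs ! i) (xs ! j)" "adj G (xs ! j) (xs ! i)"
        using e(1) uv ij by (auto simp: adj_def insert_commute)
      then have "j = Suc i \<or> i = Suc j" using short[of i j] short[of j i] ij uv
        by (metis Suc_lessI linorder_neqE_nat)
      then show ?thesis using path_graph_edge_iff[OF dist, of i j] ij uv by (auto simp: n_def)
    qed
    moreover have "edges ?R \<subseteq> edges G" using consec by (auto simp: path_graph_def n_def adj_def)
    moreover have "e \<subseteq> set xs" if "e \<in> edges ?R" for e
      using that by (auto simp: path_graph_def)
    ultimately have "edges ?R = {e \<in> edges G. e \<subseteq> set xs}" by auto
    moreover have "set xs \<subseteq> verts G" using sX X(1) by blast
    ultimately have "?R = induced G (set xs)"
      by (auto simp: path_graph_def induced_def)
    then show ?thesis using \<open>set xs \<subseteq> verts G\<close> unfolding induced_subgraph_def by blast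
  qed
  moreover have "path_between ?R (hd xs) (last xs)"
    using ne dist unfolding path_between_def by blast
  moreover have "\<exists>L\<in>components (delete_verts G S). set xs - {hd xs, last xs} \<subseteq> verts L"
  proof -
    let ?D = "delete_verts G S"
    have inD: "xs ! i \<in> verts ?D" if "0 < i" "Suc i < n" for i
    proof -
      have "xs ! i \<in> X" using sX that by (auto simp: n_def)
      then show ?thesis using inner[OF that] X(1) by auto
    qed
    have reach: "(xs ! 1, xs ! Suc i) \<in> connectivity ?D" if "Suc (Suc i) < n" for i
      using that
    proof (induction i)
      case 0
      then show ?case using inD[of 1] by (simp add: connectivity_def)
    next
      case (Suc i)
      then have "adj ?D (xs ! Suc i) (xs ! Suc (Suc i))"
        using consec[of "Suc i"] inD[of "Suc i"] inD[of "Suc (Suc i)"] by (simp add: adj_delete)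
      then show ?case using Suc inD[of "Suc (Suc i)"]
        by (auto simp: connectivity_def intro: rtrancl_into_rtrancl)
    qed
    obtain L where L: "L \<in> components ?D" "L = induced ?D (connectivity ?D `` {xs ! 1})"
      using component_exists[of "xs ! 1" ?D] inD[of 1] n3 by auto
    have "v \<in> verts L" if "v \<in> set xs" "v \<noteq> hd xs" "v \<noteq> last xs" for v
    proof -
      obtain i where i: "i < n" "v = xs ! i" using \<open>v \<in> set xs\<close> by (auto simp: in_set_conv_nth n_def)
      have "i \<noteq> 0" using that(2) i(2) h0 by metis
      moreover have "i \<noteq> n - 1" using that(3) i(2) ln by metis
      ultimately have "0 < i" "Suc i < n" using i by auto
      then show ?thesis using reach[of "i - 1"] inD[of i] L(2) i(2) by (auto simp: induced_def)
    qed
    then show ?thesis using L(1) by (intro bexI[of _ L]) auto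
  qed
  ultimately have "route G S ?R (hd xs) (last xs)"
    using hS lS hl unfolding route_def by simp
  then show ?thesis using sX by (metis verts_path_graph)
qed

lemma route_between_exists:
  assumes "simple_graph G" "stable G S" "X \<subseteq> verts G" "linked G X"
    and XS: "X \<inter> S = {s, t}" "s \<noteq> t"
  shows "\<exists>R. route G S R s t \<and> verts R \<subseteq> X"
proof -
  obtain R x y where R: "route G S R x y" "verts R \<subseteq> X"
    using route_exists[OF assms(1-4), of s t] XS by blast
  have "x \<in> verts R" "y \<in> verts R"
    using R(1) unfolding route_def path_between_def by (metis hd_in_set last_in_set verts_path_graph)+
  then have "{x, y} \<subseteq> {s, t}" "x \<noteq> y" using R XS(1) unfolding route_def by blast+
  then have "route G S R s t" using R(1) route_sym[OF R(1)] by auto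
  then show ?thesis using R(2) by blast
qed


section \<open>Ample interrupted constellations\<close>

lemma component_path:
  assumes "constellation c S" "v \<in> verts c - S"
  obtains xs where "path_graph xs \<in> components (delete_verts c S)" "distinct xs" "v \<in> set xs"
    "\<And>u. u \<in> verts c - S \<Longrightarrow> adj c v u \<Longrightarrow> u \<in> set xs \<and> adj (path_graph xs) v u"
proof -
  obtain L where L: "L \<in> components (delete_verts c S)" "v \<in> verts L"
    using component_exists[of v "delete_verts c S"] assms(2) by auto
  then obtain xs where xs: "L = path_graph xs" "distinct xs"
    using assms(1) unfolding constellation_def is_path_def path_between_def by blast
  show thesis
  proof
    fix u assume "u \<in> verts c - S" "adj c v u"
    then show "u \<in> set xs \<and> adj (path_graph xs) v u"
      using component_adj[OF L, of u] assms(2) xs(1) by (auto simp: adj_delete)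
  qed (use L xs in auto)
qed

lemma degree_outside_le_2:
  assumes "constellation c S" "v \<in> verts c - S"
  shows "card {u \<in> verts c - S. adj c v u} \<le> 2"
proof -
  obtain xs where xs: "distinct xs" "v \<in> set xs"
    "\<And>u. u \<in> verts c - S \<Longrightarrow> adj c v u \<Longrightarrow> u \<in> set xs \<and> adj (path_graph xs) v u"
    using component_path[OF assms] by metis
  obtain i where i: "i < length xs" "v = xs ! i" using xs(2) by (auto simp: in_set_conv_nth)
  have "{u \<in> verts c - S. adj c v u} \<subseteq> {xs ! (i - 1), xs ! Suc i}"
  proof
    fix u assume "u \<in> {u \<in> verts c - S. adj c v u}"
    then have "u \<in> set xs" "adj (path_graph xs) v u" using xs(3) by blast+
    then obtain j where "j < length xs" "u = xs ! j" "j = Suc i \<or> i = Suc j"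
      using path_graph_edge_iff[OF xs(1) i(1)] i(2) by (auto simp: in_set_conv_nth adj_def)
    then show "u \<in> {xs ! (i - 1), xs ! Suc i}" by auto
  qed
  then have "card {u \<in> verts c - S. adj c v u} \<le> card {xs ! (i - 1), xs ! Suc i}"
    by (intro card_mono) auto
  also have "\<dots> \<le> 2" by (simp add: card_insert_if)
  finally show ?thesis .
qed

lemma no_triangle_outside:
  assumes "constellation c S" "x \<in> verts c - S" "y \<in> verts c - S" "z \<in> verts c - S"
    and "adj c x y" "adj c y z" "adj c x z"
  shows False
proof -
  obtain xs where P: "path_graph xs \<in> components (delete_verts c S)" and xs: "distinct xs" "x \<in> set xs"
    "\<And>u. u \<in> verts c - S \<Longrightarrow> adj c x u \<Longrightarrow> u \<in> set xs \<and> adj (path_graph xs) x u"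
    using component_path[OF assms(1,2)] by metis
  have yz: "y \<in> set xs" "adj (path_graph xs) x y" "z \<in> set xs" "adj (path_graph xs) x z"
    using xs(3) assms by blast+
  have "adj (path_graph xs) y z"
    using component_adj(2)[OF P, of y z] yz(1) assms by (auto simp: adj_delete)
  moreover obtain i j k where "i < length xs" "j < length xs" "k < length xs"
    "x = xs ! i" "y = xs ! j" "z = xs ! k"
    using xs(2) yz(1,3) by (metis in_set_conv_nth)
  ultimately have "j = Suc i \<or> i = Suc j" "k = Suc i \<or> i = Suc k" "k = Suc j \<or> j = Suc k"
    using yz path_graph_edge_iff[OF xs(1)] by (auto simp: adj_def)
  then show False by linarith
qed

lemma ample_unique_neighbor:
  assumes c: "constellation c S" "ample c S" and v: "v \<in> verts c - S"
    and st: "s \<in> S" "t \<in> S" "adj c v s" "adj c v t"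
  shows "s = t"
proof (rule ccontr)
  assume "s \<noteq> t"
  have G: "simple_graph c" "stable c S" using c(1) by (auto simp: constellation_def)
  have "s \<in> verts c" "t \<in> verts c" using G(2) st by (auto simp: stable_def)
  have "linked c (set [s, v, t])"
    by (rule linked_walk) (use st in \<open>auto simp: adj_sym\<close>)
  then obtain R x y where R: "route c S R x y" "verts R \<subseteq> {s, v, t}"
    using route_exists[OF G, of "{s, v, t}" s t] v st \<open>s \<noteq> t\<close> \<open>s \<in> verts c\<close> \<open>t \<in> verts c\<close>
    by auto
  then obtain xs where xs: "R = path_graph xs" "distinct xs"
    unfolding route_def path_between_def by blast
  have "length xs \<le> 3"
  proof -
    have "card (set xs) \<le> card {s, v, t}" using R(2) xs by (intro card_mono) auto
    also have "\<dots> \<le> 3" by (simp add: card_insert_if)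
    finally show ?thesis using distinct_card[OF xs(2)] by simp
  qed
  moreover have "path_length R \<le> length xs - 1"
    unfolding path_length_def xs(1) edges_path_graph
    by (metis card_image_le card_lessThan finite_lessThan)
  ultimately have "path_length R \<le> 2" by linarith
  then show False using c(2) R(1) by (auto simp: ample_def)
qed

lemma linear_order_max:
  assumes "linear_order_on S r" "finite A" "A \<noteq> {}" "A \<subseteq> S"
  shows "\<exists>m\<in>A. \<forall>a\<in>A. (a, m) \<in> r"
  using assms(2,3,4)
proof (induction rule: finite_ne_induct)
  case (singleton x)
  then show ?case using assms(1) by (auto simp: order_on_defs refl_on_def)
next
  case (insert x F)
  then obtain m where m: "m \<in> F" "\<forall>a\<in>F. (a, m) \<in> r" by auto
  have refl: "(x, x) \<in> r" and tr: "trans r" and tot: "(x, m) \<in> r \<or> (m, x) \<in> r"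
    using assms(1) insert.prems m(1) insert.hyps
    by (auto simp: order_on_defs refl_on_def total_on_def)
  then show ?case
  proof (cases "(x, m) \<in> r")
    case True
    then show ?thesis using m by auto
  next
    case False
    then have "(m, x) \<in> r" using tot by blast
    then show ?thesis using m refl tr by (auto intro!: bexI[of _ x] dest: transD)
  qed
qed

lemma linear_order_min:
  assumes "linear_order_on S r" "finite A" "A \<noteq> {}" "A \<subseteq> S"
  shows "\<exists>m\<in>A. \<forall>a\<in>A. (m, a) \<in> r"
  using linear_order_max[of S "r\<inverse>" A] assms by (simp add: linear_order_on_converse)

text \<open>Let \<open>k\<close> be the greatest vertex of \<open>A\<close>.  Every route between two other vertices of \<open>A\<close> meets
  the neighborhood of \<open>k\<close>, so the closed neighborhood of \<open>k\<close> separates the other vertices of \<open>A\<close>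
  from each other within any set whose stable vertices belong to \<open>A\<close>.\<close>

lemma interrupted_separator:
  assumes c: "constellation c S" "interrupted c S" and A: "A \<subseteq> S" "A \<noteq> {}"
  shows "\<exists>k\<in>A. \<forall>X\<subseteq>verts c. X \<inter> S \<subseteq> A \<and> linked c X \<and> k \<notin> X \<and> (\<forall>x\<in>X. \<not> adj c k x) \<longrightarrow>
    (\<forall>s\<in>X \<inter> S. \<forall>t\<in>X \<inter> S. s = t)"
proof -
  have G: "simple_graph c" "stable c S" using c(1) by (auto simp: constellation_def)
  have fin: "finite A" using G A(1) unfolding simple_graph_def stable_def
    by (meson finite_subset)
  obtain r where r: "linear_order_on S r" and int: "\<And>x y z R. x \<in> S \<Longrightarrow> y \<in> S \<Longrightarrow> z \<in> S \<Longrightarrow>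
      (x, y) \<in> r \<Longrightarrow> x \<noteq> y \<Longrightarrow> (y, z) \<in> r \<Longrightarrow> y \<noteq> z \<Longrightarrow> route c S R x y \<Longrightarrow> has_neighbor_in c z R"
    using c(2) unfolding interrupted_def by blast
  obtain k where k: "k \<in> A" "\<And>a. a \<in> A \<Longrightarrow> (a, k) \<in> r"
    using linear_order_max[OF r fin A(2,1)] by blast
  have False if X: "X \<subseteq> verts c" "X \<inter> S \<subseteq> A" "linked c X" "k \<notin> X" "\<forall>x\<in>X. \<not> adj c k x"
    and st: "s \<in> X \<inter> S" "t \<in> X \<inter> S" "s \<noteq> t" for X s t
  proof -
    obtain R x y where R: "route c S R x y" "verts R \<subseteq> X"
      using route_exists[OF G X(1,3) st] by blast
    have ends: "x \<in> verts R" "y \<in> verts R" "x \<in> S" "y \<in> S" "x \<noteq> y"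
      using R(1) unfolding route_def path_between_def
      by (metis hd_in_set last_in_set verts_path_graph)+
    then have "x \<in> A" "y \<in> A" "x \<noteq> k" "y \<noteq> k" using R(2) X(2,4) by blast+
    moreover have "(x, y) \<in> r \<or> (y, x) \<in> r"
      using r ends by (auto simp: order_on_defs total_on_def)
    ultimately have "has_neighbor_in c k R"
      using int[of x y k R] int[of y x k R] k ends A(1) R(1) route_sym[OF R(1)] by blast
    then show False using X(5) R(2) by (auto simp: has_neighbor_in_def)
  qed
  then show ?thesis using k(1) by blast
qed

text \<open>The properties of an induced subgraph \<open>G\<close> of an ample interrupted constellation that are
  used below; \<open>S\<close> is the part of the stable set that lies in \<open>G\<close>.  They mention the constellation
  no longer, so they can be stated for any graph isomorphic to an induced subgraph of it.\<close>

definition separable :: "'a graph \<Rightarrow> 'a set \<Rightarrow> bool" where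
  "separable G S \<longleftrightarrow> stable G S \<and>
     (\<forall>v\<in>verts G - S. card {u \<in> verts G. adj G v u} \<le> 3 \<and>
        (card {u \<in> verts G. adj G v u} \<ge> 3 \<longrightarrow> (\<exists>s\<in>S. adj G v s))) \<and>
     (\<forall>x\<in>verts G. \<forall>y\<in>verts G. \<forall>z\<in>verts G. adj G x y \<and> adj G y z \<and> adj G x z \<longrightarrow>
        x \<in> S \<or> y \<in> S \<or> z \<in> S) \<and>
     (S \<noteq> {} \<longrightarrow> (\<exists>k\<in>S. \<forall>X\<subseteq>verts G. linked G X \<and> k \<notin> X \<and> (\<forall>x\<in>X. \<not> adj G k x) \<longrightarrow>
        (\<forall>s\<in>X \<inter> S. \<forall>t\<in>X \<inter> S. s = t)))"

lemma separable_degree: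
  assumes "separable G S" "v \<in> verts G - S"
  shows "card {u \<in> verts G. adj G v u} \<le> 3"
    and "card {u \<in> verts G. adj G v u} \<ge> 3 \<Longrightarrow> \<exists>s\<in>S. adj G v s"
  using assms by (simp_all add: separable_def)

lemma separable_triangle:
  assumes "separable G S" "x \<in> verts G" "y \<in> verts G" "z \<in> verts G"
    "adj G x y" "adj G y z" "adj G x z"
  shows "x \<in> S \<or> y \<in> S \<or> z \<in> S"
proof -
  have "\<forall>x\<in>verts G. \<forall>y\<in>verts G. \<forall>z\<in>verts G. adj G x y \<and> adj G y z \<and> adj G x z \<longrightarrow>
        x \<in> S \<or> y \<in> S \<or> z \<in> S"
    using assms(1) by (simp add: separable_def)
  then show ?thesis using assms(2-7) by blast
qed

lemma separable_separator:
  assumes "separable G S" "S \<noteq> {}"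
  shows "\<exists>k\<in>S. \<forall>X\<subseteq>verts G. linked G X \<and> k \<notin> X \<and> (\<forall>x\<in>X. \<not> adj G k x) \<longrightarrow>
    (\<forall>s\<in>X \<inter> S. \<forall>t\<in>X \<inter> S. s = t)"
  using assms by (simp add: separable_def)

lemma contains_induced_embedding:
  assumes "contains_induced G H"
  obtains g where "inj_on g (verts H)" "g ` verts H \<subseteq> verts G"
    "\<And>u v. u \<in> verts H \<Longrightarrow> v \<in> verts H \<Longrightarrow> adj H u v \<longleftrightarrow> adj G (g u) (g v)"
proof -
  obtain X f where X: "X \<subseteq> verts G" and f: "bij_betw f (verts (induced G X)) (verts H)"
    "\<And>u v. u \<in> verts (induced G X) \<Longrightarrow> v \<in> verts (induced G X) \<Longrightarrow>
        adj (induced G X) u v \<longleftrightarrow> adj H (f u) (f v)"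
    using assms unfolding contains_induced_def induced_subgraph_def isomorphic_def by blast
  have vX: "verts (induced G X) = X" using X by (auto simp: induced_def)
  let ?g = "inv_into X f"
  have b: "bij_betw ?g (verts H) X" using f(1) bij_betw_inv_into unfolding vX by blast
  show thesis
  proof
    show "inj_on ?g (verts H)" "?g ` verts H \<subseteq> verts G"
      using b X by (auto simp: bij_betw_def)
    fix u v assume uv: "u \<in> verts H" "v \<in> verts H"
    then have g: "?g u \<in> X" "?g v \<in> X" "f (?g u) = u" "f (?g v) = v"
      using b f(1) by (auto simp: vX bij_betw_def f_inv_into_f)
    have "adj H u v \<longleftrightarrow> adj (induced G X) (?g u) (?g v)"
      using f(2)[of "?g u" "?g v"] g by (simp add: vX)
    also have "\<dots> \<longleftrightarrow> adj G (?g u) (?g v)" using g by (simp add: induced_def adj_def)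
    finally show "adj H u v \<longleftrightarrow> adj G (?g u) (?g v)" .
  qed
qed

lemma contains_induced_separable:
  assumes c: "constellation c S" "ample c S" "interrupted c S" and H: "contains_induced c H"
  shows "\<exists>S'. separable H S'"
proof -
  obtain g where inj: "inj_on g (verts H)" and im: "g ` verts H \<subseteq> verts c"
    and adj: "\<And>u v. u \<in> verts H \<Longrightarrow> v \<in> verts H \<Longrightarrow> adj H u v \<longleftrightarrow> adj c (g u) (g v)"
    using contains_induced_embedding[OF H] by metis
  define S' where "S' = {v \<in> verts H. g v \<in> S}"
  have G: "simple_graph c" "stable c S" using c(1) by (auto simp: constellation_def)
  have fin: "finite (verts c)" using G(1) by (simp add: simple_graph_def)
  have "stable H S'" using G(2) adj by (auto simp: stable_def S'_def)
  moreover have "card {u \<in> verts H. adj H v u} \<le> 3 \<and>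
      (card {u \<in> verts H. adj H v u} \<ge> 3 \<longrightarrow> (\<exists>s\<in>S'. adj H v s))" if v: "v \<in> verts H - S'" for v
  proof -
    let ?N = "{u \<in> verts H. adj H v u}"
    have gv: "g v \<in> verts c - S" using v im by (auto simp: S'_def)
    have sub: "g ` (?N - S') \<subseteq> {u \<in> verts c - S. adj c (g v) u}"
      using im adj v by (auto simp: S'_def)
    have finN: "finite ?N"
      using inj_on_finite[OF inj im fin] by simp
    have "card (?N - S') = card (g ` (?N - S'))"
      by (rule card_image[symmetric]) (rule inj_on_subset[OF inj], auto)
    also have "\<dots> \<le> card {u \<in> verts c - S. adj c (g v) u}"
      by (rule card_mono) (use sub fin in auto)
    also have "\<dots> \<le> 2" by (rule degree_outside_le_2[OF c(1) gv])
    finally have out: "card (?N - S') \<le> 2" .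
    have uniq: "\<forall>s\<in>?N \<inter> S'. \<forall>t\<in>?N \<inter> S'. s = t"
    proof (intro ballI)
      fix s t assume that: "s \<in> ?N \<inter> S'" "t \<in> ?N \<inter> S'"
      have "g s = g t"
        using ample_unique_neighbor[OF c(1,2) gv, of "g s" "g t"] adj that v by (auto simp: S'_def)
      then show "s = t" using inj that by (auto simp: inj_on_def)
    qed
    have "finite (?N \<inter> S')" using finN by simp
    then have ins: "card (?N \<inter> S') \<le> 1"
      unfolding One_nat_def using uniq by (rule card_le_Suc0_iff_eq[THEN iffD2])
    have tot: "card ?N = card (?N - S') + card (?N \<inter> S')"
      using card_Int_Diff[OF finN, of S'] by linarith
    have "\<exists>s\<in>S'. adj H v s" if "card ?N \<ge> 3"
    proof -
      have "card (?N \<inter> S') \<noteq> 0" using that out tot by linarith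
      then have "?N \<inter> S' \<noteq> {}" by force
      then show ?thesis by blast
    qed
    moreover have "card ?N \<le> 3" using out ins tot by linarith
    ultimately show ?thesis by blast
  qed
  moreover have "x \<in> S' \<or> y \<in> S' \<or> z \<in> S'"
    if "x \<in> verts H" "y \<in> verts H" "z \<in> verts H" "adj H x y" "adj H y z" "adj H x z" for x y z
  proof (rule ccontr)
    assume "\<not> (x \<in> S' \<or> y \<in> S' \<or> z \<in> S')"
    then show False
      using no_triangle_outside[OF c(1), of "g x" "g y" "g z"] that adj im by (auto simp: S'_def)
  qed
  moreover have "\<exists>k\<in>S'. \<forall>X\<subseteq>verts H. linked H X \<and> k \<notin> X \<and> (\<forall>x\<in>X. \<not> adj H k x) \<longrightarrow>
        (\<forall>s\<in>X \<inter> S'. \<forall>t\<in>X \<inter> S'. s = t)" if "S' \<noteq> {}"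
  proof -
    have "g ` S' \<subseteq> S" "g ` S' \<noteq> {}" using that by (auto simp: S'_def)
    from interrupted_separator[OF c(1,3) this] obtain k' where k': "k' \<in> g ` S'" and sep': "\<forall>X\<subseteq>verts c. X \<inter> S \<subseteq> g ` S' \<and> linked c X \<and>
        k' \<notin> X \<and> (\<forall>x\<in>X. \<not> adj c k' x) \<longrightarrow> (\<forall>s\<in>X \<inter> S. \<forall>t\<in>X \<inter> S. s = t)"
      by (elim bexE)
    obtain k where k: "k \<in> S'" "k' = g k" using k' by blast
    have sep: "\<forall>X\<subseteq>verts c. X \<inter> S \<subseteq> g ` S' \<and> linked c X \<and>
        g k \<notin> X \<and> (\<forall>x\<in>X. \<not> adj c (g k) x) \<longrightarrow> (\<forall>s\<in>X \<inter> S. \<forall>t\<in>X \<inter> S. s = t)"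
      using sep' unfolding k(2) .
    have kv: "k \<in> verts H" using k(1) by (simp add: S'_def)
    have "s = t" if X: "X \<subseteq> verts H" "linked H X" "k \<notin> X" "\<forall>x\<in>X. \<not> adj H k x"
      and st: "s \<in> X \<inter> S'" "t \<in> X \<inter> S'" for X s t
    proof -
      have 1: "g ` X \<subseteq> verts c" using X(1) im by auto
      have 2: "g ` X \<inter> S \<subseteq> g ` S'" using X(1) by (auto simp: S'_def)
      have 3: "linked c (g ` X)"
        by (rule linked_image[OF X(2)]) (use adj X(1) in auto)
      have 4: "g k \<notin> g ` X" using inj X(1,3) kv by (auto simp: inj_on_def)
      have 5: "\<forall>x\<in>g ` X. \<not> adj c (g k) x" using X(1,4) adj kv by auto
      have "g s \<in> g ` X \<inter> S" "g t \<in> g ` X \<inter> S" using st by (auto simp: S'_def)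
      moreover have "\<forall>s\<in>g ` X \<inter> S. \<forall>t\<in>g ` X \<inter> S. s = t"
        using sep[rule_format, OF 1] 2 3 4 5 by blast
      ultimately have "g s = g t" by blast
      then show ?thesis using inj st X(1) by (auto simp: inj_on_def)
    qed
    then show ?thesis using k(1) by (intro bexI[of _ k] allI impI ballI) auto
  qed
  ultimately have "separable H S'" unfolding separable_def by (intro conjI ballI impI) auto
  then show ?thesis ..
qed


section \<open>Graphs with six separated pairs of hubs\<close>

text \<open>A hub is a vertex that has degree at least three or lies in a triangle.  In a separable graph
  its closed neighborhood meets \<open>S\<close>.\<close>

definition hub :: "'a graph \<Rightarrow> 'a \<Rightarrow> bool" where
  "hub G v \<longleftrightarrow> v \<in> verts G \<and> (card {u \<in> verts G. adj G v u} \<ge> 3 \<or>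
     (\<exists>x\<in>verts G. \<exists>y\<in>verts G. adj G v x \<and> adj G x y \<and> adj G v y))"

lemma hub_near_stable:
  assumes "separable G S" "hub G v"
  shows "\<exists>s\<in>S. s = v \<or> adj G v s"
proof (cases "v \<in> S")
  case False
  then have v: "v \<in> verts G - S" using assms(2) by (simp add: hub_def)
  show ?thesis
  proof (cases "card {u \<in> verts G. adj G v u} \<ge> 3")
    case True
    then show ?thesis using separable_degree(2)[OF assms(1) v] by blast
  next
    case False
    then obtain x y where xy: "x \<in> verts G" "y \<in> verts G" "adj G v x" "adj G x y" "adj G v y"
      using assms(2) unfolding hub_def by blast
    then have "v \<in> S \<or> x \<in> S \<or> y \<in> S" using separable_triangle[OF assms(1)] v by blast
    then show ?thesis using v xy by blast
  qed
qed blast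

text \<open>The sets are six in number because the closed neighborhood of one vertex, of size at most five,
  cannot meet all of them.\<close>

lemma not_separable_six_hub_pairs:
  assumes deg: "\<And>v. v \<in> verts G \<Longrightarrow> finite {u \<in> verts G. adj G v u} \<and>
      card (insert v {u \<in> verts G. adj G v u}) \<le> 5"
    and A: "\<And>i. i < (6::nat) \<Longrightarrow> A i \<subseteq> verts G \<and> linked G (A i)"
    and disj: "\<And>i j. i < 6 \<Longrightarrow> j < 6 \<Longrightarrow> i \<noteq> j \<Longrightarrow> A i \<inter> A j = {}"
    and hubs: "\<And>i. i < 6 \<Longrightarrow> \<exists>u\<in>A i. \<exists>w\<in>A i. hub G u \<and> hub G w \<and>
      \<not> (\<exists>x. (x = u \<or> adj G u x) \<and> (x = w \<or> adj G w x))"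
  shows "\<not> separable G S"
proof
  assume sep: "separable G S"
  then have S: "stable G S" by (simp add: separable_def)
  obtain u0 where "hub G u0" using hubs[of 0] by auto
  then have "S \<noteq> {}" using hub_near_stable[OF sep] by blast
  from separable_separator[OF sep this] obtain k where k: "k \<in> S"
    and kX: "\<forall>X\<subseteq>verts G. linked G X \<and> k \<notin> X \<and> (\<forall>x\<in>X. \<not> adj G k x) \<longrightarrow>
      (\<forall>s\<in>X \<inter> S. \<forall>t\<in>X \<inter> S. s = t)"
    by (elim bexE)
  let ?N = "insert k {u \<in> verts G. adj G k u}"
  have N: "finite ?N" "card ?N \<le> 5" using deg[of k] k S by (auto simp: stable_def)
  have "\<exists>i<6. A i \<inter> ?N = {}"
  proof (rule ccontr)
    assume "\<not> (\<exists>i<6. A i \<inter> ?N = {})"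
    then have "\<forall>i\<in>{..<6}. \<exists>x. x \<in> A i \<inter> ?N" by blast
    then obtain h where h: "\<forall>i\<in>{..<6}. h i \<in> A i \<inter> ?N" by metis
    have "inj_on h {..<6}"
      using h disj by (intro inj_onI) (metis IntD1 disjoint_iff lessThan_iff)
    moreover have "h ` {..<6} \<subseteq> ?N" using h by blast
    ultimately have "card {..<6::nat} \<le> card ?N" using N(1) by (metis card_inj_on_le)
    then show False using N(2) by simp
  qed
  then obtain i where i: "i < 6" "A i \<inter> ?N = {}" by blast
  obtain u w where uw: "u \<in> A i" "w \<in> A i" "hub G u" "hub G w"
    and far: "\<not> (\<exists>x. (x = u \<or> adj G u x) \<and> (x = w \<or> adj G w x))"
    using hubs[OF i(1)] by blast
  obtain s t where s: "s \<in> S" "s = u \<or> adj G u s" and t: "t \<in> S" "t = w \<or> adj G w t"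
    using hub_near_stable[OF sep] uw by metis
  let ?X = "insert s (insert t (A i))"
  have AG: "A i \<subseteq> verts G" "linked G (A i)" using A[OF i(1)] by auto
  have 1: "?X \<subseteq> verts G" using AG s t S by (auto simp: stable_def)
  have "linked G (insert t (A i))"
    using t(2) linked_insert[OF AG(2) uw(2)] AG(2) uw(2) by (auto simp: insert_absorb)
  then have 2: "linked G ?X"
    using s(2) linked_insert[of G "insert t (A i)" u s] uw(1) by (auto simp: insert_absorb)
  have avoid: "x \<noteq> k \<and> \<not> adj G k x" if "x \<in> A i" for x
    using that i(2) AG(1) by auto
  have "s \<noteq> k" "t \<noteq> k" using s t avoid uw by (metis adj_sym)+
  moreover have "\<not> adj G k s" "\<not> adj G k t" using S k s t by (auto simp: stable_def)
  ultimately have 3: "k \<notin> ?X" "\<forall>x\<in>?X. \<not> adj G k x" using avoid by auto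
  have "\<forall>s\<in>?X \<inter> S. \<forall>t\<in>?X \<inter> S. s = t" using kX[rule_format, OF 1] 2 3 by blast
  then have "s = t" using s(1) t(1) by blast
  then show False using far s t by blast
qed

section \<open>Subdivisions and their line graphs\<close>

lemma path_graph_edge:
  assumes "distinct xs" "a \<in> edges (path_graph xs)"
  shows "a \<subseteq> set xs" "card a = 2"
  using assms by (auto simp: path_graph_def nth_eq_iff_index_eq)

lemma finite_edges_path_graph: "finite (edges (path_graph xs))"
  by (simp add: edges_path_graph)

lemma edges_path_graph_Cons:
  "edges (path_graph (x # y # zs)) = insert {x, y} (edges (path_graph (y # zs)))"
proof -
  have "{{(x # y # zs) ! i, (x # y # zs) ! Suc i} | i. Suc i < length (x # y # zs)} =
      insert {x, y} {{(y # zs) ! i, (y # zs) ! Suc i} | i. Suc i < length (y # zs)}"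
    (is "?A = insert _ ?B")
  proof
    show "?A \<subseteq> insert {x, y} ?B"
    proof
      fix e assume "e \<in> ?A"
      then obtain i where "e = {(x # y # zs) ! i, (x # y # zs) ! Suc i}" "Suc i < length (x # y # zs)"
        by blast
      then show "e \<in> insert {x, y} ?B" by (cases i) auto
    qed
    show "insert {x, y} ?B \<subseteq> ?A"
    proof
      fix e assume "e \<in> insert {x, y} ?B"
      then consider "e = {x, y}" | i where "e = {(y # zs) ! i, (y # zs) ! Suc i}" "Suc i < length (y # zs)"
        by blast
      then show "e \<in> ?A"
      proof cases
        case 1
        then show ?thesis by (intro CollectI exI[of _ 0]) simp
      next
        case 2
        then show ?thesis by (intro CollectI exI[of _ "Suc i"]) simp
      qed
    qed
  qed
  then show ?thesis by (simp add: path_graph_def)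
qed

lemma path_graph_end_edge:
  assumes "distinct xs" "xs \<noteq> []" "a \<in> edges (path_graph xs)" "a' \<in> edges (path_graph xs)"
    "hd xs \<in> a" "hd xs \<in> a'"
  shows "a = a'"
proof -
  have "c = {xs ! 0, xs ! 1}" if "c \<in> edges (path_graph xs)" "hd xs \<in> c" for c
    using that assms(1,2) by (auto simp: path_graph_def hd_conv_nth nth_eq_iff_index_eq)
  then show ?thesis using assms by metis
qed

lemma path_graph_edges_at:
  assumes "distinct xs"
  shows "card {a \<in> edges (path_graph xs). x \<in> a} \<le> 2"
proof (cases "x \<in> set xs")
  case True
  then obtain i where i: "i < length xs" "x = xs ! i" by (auto simp: in_set_conv_nth)
  have "{a \<in> edges (path_graph xs). x \<in> a} \<subseteq> {{xs ! (i - 1), xs ! i}, {xs ! i, xs ! Suc i}}"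
    using i assms by (auto simp: path_graph_def nth_eq_iff_index_eq)
  then have "card {a \<in> edges (path_graph xs). x \<in> a} \<le>
      card {{xs ! (i - 1), xs ! i}, {xs ! i, xs ! Suc i}}"
    by (intro card_mono) auto
  also have "\<dots> \<le> 2" by (simp add: card_insert_if)
  finally show ?thesis .
next
  case False
  then have none: "{a \<in> edges (path_graph xs). x \<in> a} = {}"
    using path_graph_edge(1)[OF assms] by blast
  show ?thesis unfolding none by simp
qed

lemma adj_line_graph:
  "adj (line_graph G) e f \<longleftrightarrow> e \<in> edges G \<and> f \<in> edges G \<and> e \<noteq> f \<and> e \<inter> f \<noteq> {}"
  by (auto simp: adj_def line_graph_def doubleton_eq_iff)

lemma verts_line_graph [simp]: "verts (line_graph G) = edges G"
  by (simp add: line_graph_def)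

text \<open>The edges of a path, listed in order, form a walk in the line graph.\<close>

lemma linked_line_path:
  assumes "distinct xs" "edges (path_graph xs) \<subseteq> edges G"
  shows "linked (line_graph G) (edges (path_graph xs))"
proof -
  let ?es = "map (\<lambda>i. {xs ! i, xs ! Suc i}) [0..<length xs - 1]"
  have "Suc i < length xs \<longleftrightarrow> i < length xs - 1" for i by linarith
  then have set: "set ?es = edges (path_graph xs)"
    unfolding path_graph_def set_map by auto
  have "successively (adj (line_graph G)) ?es"
  proof (subst successively_conv_nth, intro allI impI)
    fix i assume "Suc i < length ?es"
    then have i: "Suc (Suc i) < length xs" by simp
    have "xs ! i \<noteq> xs ! Suc i" "xs ! i \<noteq> xs ! Suc (Suc i)"
      using i assms(1) by (simp_all add: nth_eq_iff_index_eq)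
    then have "{xs ! i, xs ! Suc i} \<noteq> {xs ! Suc i, xs ! Suc (Suc i)}" by blast
    moreover have "{xs ! i, xs ! Suc i} \<in> edges (path_graph xs)"
      "{xs ! Suc i, xs ! Suc (Suc i)} \<in> edges (path_graph xs)"
      using i by (simp_all add: path_graph_edgeI)
    then have "{xs ! i, xs ! Suc i} \<in> edges G" "{xs ! Suc i, xs ! Suc (Suc i)} \<in> edges G"
      using assms(2) by blast+
    moreover have "[0..<length xs - 1] ! i = i" "[0..<length xs - 1] ! Suc i = Suc i"
      using i nth_upt[of 0 i "length xs - 1"] nth_upt[of 0 "Suc i" "length xs - 1"] by simp_all
    then have "?es ! i = {xs ! i, xs ! Suc i}" "?es ! Suc i = {xs ! Suc i, xs ! Suc (Suc i)}"
      using i by simp_all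
    moreover have "{xs ! i, xs ! Suc i} \<inter> {xs ! Suc i, xs ! Suc (Suc i)} \<noteq> {}" by blast
    ultimately show "adj (line_graph G) (?es ! i) (?es ! Suc i)"
      by (simp only: adj_line_graph not_False_eq_True)
  qed
  then show ?thesis using linked_walk set by metis
qed

text \<open>Two vertices are remote if no edge meets both an edge at one of them and an edge at the
  other; for non-isolated vertices this says that their distance is at least four.  Distance three
  would do for subdivisions, but in the line graph the edges at the ends of a path of length three
  have a common neighbor.\<close>

definition remote :: "'a graph \<Rightarrow> 'a \<Rightarrow> 'a \<Rightarrow> bool" where
  "remote G u v \<longleftrightarrow> \<not> (\<exists>e\<in>edges G. \<exists>f\<in>edges G. \<exists>g\<in>edges G.
     u \<in> e \<and> v \<in> f \<and> e \<inter> g \<noteq> {} \<and> f \<inter> g \<noteq> {})"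

text \<open>A graph of maximum degree at most three with six disjoint walks, each joining two remote
  vertices of degree three.  Degrees are counted by incident edges.\<close>

definition has_six_paths :: "'a graph \<Rightarrow> bool" where
  "has_six_paths G \<longleftrightarrow> simple_graph G \<and> (\<forall>v. card {e \<in> edges G. v \<in> e} \<le> 3) \<and>
     (\<exists>p :: nat \<Rightarrow> 'a list.
        (\<forall>i<6. p i \<noteq> [] \<and> successively (adj G) (p i) \<and> remote G (hd (p i)) (last (p i)) \<and>
           card {e \<in> edges G. hd (p i) \<in> e} = 3 \<and> card {e \<in> edges G. last (p i) \<in> e} = 3) \<and>
        (\<forall>i<6. \<forall>j<6. i \<noteq> j \<longrightarrow> set (p i) \<inter> set (p j) = {}))"

lemma edge_exists_if_card_3:
  assumes "card {e \<in> E. v \<in> e} = 3"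
  obtains e where "e \<in> E" "v \<in> e"
proof -
  have "{e \<in> E. v \<in> e} \<noteq> {}" using assms by (metis card.empty zero_neq_numeral)
  then show thesis using that by blast
qed

text \<open>\<open>H\<close> is a subdivision of \<open>B\<close>: a vertex \<open>v\<close> of \<open>B\<close> becomes the vertex \<open>b v\<close> and an edge \<open>e\<close>
  becomes the path \<open>P e\<close>.\<close>

locale subdivided_graph =
  fixes H :: "'a graph" and B :: "'b graph" and b :: "'b \<Rightarrow> 'a" and P :: "'b set \<Rightarrow> 'a graph"
  assumes simple: "simple_graph B"
    and inj: "inj_on b (verts B)"
    and paths: "\<And>u v. {u, v} \<in> edges B \<Longrightarrow>
      path_between (P {u, v}) (b u) (b v) \<and> path_length (P {u, v}) \<ge> 1"
    and interior: "\<And>e. e \<in> edges B \<Longrightarrow> (verts (P e) - b ` e) \<inter> b ` verts B = {}"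
    and interiors: "\<And>e f. e \<in> edges B \<Longrightarrow> f \<in> edges B \<Longrightarrow> e \<noteq> f \<Longrightarrow>
      (verts (P e) - b ` e) \<inter> (verts (P f) - b ` f) = {}"
    and verts: "verts H = b ` verts B \<union> (\<Union>e\<in>edges B. verts (P e))"
    and edges: "edges H = (\<Union>e\<in>edges B. edges (P e))"
begin

lemma base_edge: "e \<in> edges B \<Longrightarrow> e \<subseteq> verts B \<and> card e = 2 \<and> e \<noteq> {}"
  using simple by (auto simp: simple_graph_def)

lemma finite_base_edges: "finite (edges B)"
  using simple unfolding simple_graph_def
  by (meson PowI finite_Pow_iff finite_subset subsetI)

lemma path_at:
  assumes "e \<in> edges B" "u \<in> e"
  obtains xs where "P e = path_graph xs" "distinct xs" "hd xs = b u" "length xs \<ge> 2"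
proof -
  obtain v where v: "e = {u, v}"
    using base_edge[OF assms(1)] assms(2) by (metis card_2_iff doubleton_eq_iff insertE singletonD)
  have p: "path_between (P e) (b u) (b v)" "path_length (P e) \<ge> 1" using paths v assms(1) by auto
  then obtain xs where xs: "distinct xs" "hd xs = b u" "P e = path_graph xs"
    unfolding path_between_def by blast
  have "edges (P e) \<noteq> {}" using p(2) by (auto simp: path_length_def)
  then have "length xs \<ge> 2" by (auto simp: xs(3) path_graph_def)
  then show thesis using that xs by blast
qed

lemma path_some:
  assumes "e \<in> edges B"
  obtains xs where "P e = path_graph xs" "distinct xs"
proof -
  obtain u where "u \<in> e" using base_edge[OF assms] by blast
  then show thesis using path_at[OF assms] that by blast
qed

lemma start_edge:
  assumes "e \<in> edges B" "u \<in> e"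
  shows "\<exists>a\<in>edges (P e). b u \<in> a" "b u \<in> verts (P e)"
proof -
  obtain xs where xs: "P e = path_graph xs" "hd xs = b u" "length xs \<ge> 2"
    using path_at[OF assms] by metis
  then have ne: "xs \<noteq> []" by auto
  then have "xs ! 0 = b u" using xs(2) by (simp add: hd_conv_nth)
  then have "b u \<in> {xs ! 0, xs ! Suc 0}" by simp
  moreover have "{xs ! 0, xs ! Suc 0} \<in> edges (P e)"
    using xs(1,3) path_graph_edgeI[of 0 xs] by simp
  ultimately show "\<exists>a\<in>edges (P e). b u \<in> a" by (rule bexI)
  show "b u \<in> verts (P e)" using xs ne by (metis hd_in_set verts_path_graph)
qed

lemma paths_meet:
  assumes "e \<in> edges B" "f \<in> edges B" "e \<noteq> f" "x \<in> verts (P e)" "x \<in> verts (P f)"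
  shows "x \<in> b ` (e \<inter> f)"
proof -
  have sub: "b ` e \<subseteq> b ` verts B" "b ` f \<subseteq> b ` verts B" using base_edge assms(1,2) by blast+
  have "x \<in> b ` e \<or> x \<in> b ` f" using interiors[OF assms(1-3)] assms(4,5) by blast
  then have "x \<in> b ` verts B" using sub by blast
  then have "x \<in> b ` e" "x \<in> b ` f"
    using interior[OF assms(1)] interior[OF assms(2)] assms(4,5) by blast+
  then show ?thesis using inj_on_image_Int[OF inj, of e f] base_edge assms(1,2) by auto
qed

lemma paths_meet_ends:
  assumes "e \<in> edges B" "f \<in> edges B" "x \<in> verts (P e)" "x \<in> verts (P f)"
  shows "e \<inter> f \<noteq> {}"
  using paths_meet[OF assms(1,2) _ assms(3,4)] base_edge assms(1) by fastforce

lemma branch_in_path: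
  assumes "e \<in> edges B" "u \<in> verts B" "b u \<in> verts (P e)"
  shows "u \<in> e"
proof -
  have "b u \<in> b ` e" using interior[OF assms(1)] assms(2,3) by blast
  then show ?thesis using inj assms(2) base_edge[OF assms(1)] by (auto simp: inj_on_def)
qed

lemma path_edge:
  assumes "e \<in> edges B" "a \<in> edges (P e)"
  shows "a \<subseteq> verts (P e)" "card a = 2" "a \<in> edges H" "a \<noteq> {}"
proof -
  obtain xs where "P e = path_graph xs" "distinct xs" using path_some[OF assms(1)] .
  then show "a \<subseteq> verts (P e)" "card a = 2" using path_graph_edge assms(2) by auto
  then show "a \<noteq> {}" by auto
  show "a \<in> edges H" using assms edges by auto
qed

lemma path_edges_disjoint:
  assumes "e \<in> edges B" "f \<in> edges B" "e \<noteq> f" "a \<in> edges (P e)" "a \<in> edges (P f)"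
  shows False
proof -
  have ef: "card e = 2" "card f = 2" using base_edge assms(1,2) by auto
  then have fin: "finite e" "finite f" by (auto intro: card_ge_0_finite)
  have "e \<inter> f \<noteq> e" using assms(3) ef fin by (metis card_subset_eq inf_le2)
  then have "card (e \<inter> f) < 2" using fin ef psubset_card_mono[of e "e \<inter> f"] by auto
  moreover have "a \<subseteq> b ` (e \<inter> f)"
    using paths_meet[OF assms(1-3)] path_edge(1)[OF assms(1,4)] path_edge(1)[OF assms(2,5)] by blast
  then have "card a \<le> card (e \<inter> f)"
    using fin by (meson card_image_le card_mono finite_Int finite_imageI le_trans)
  ultimately show False using path_edge(2)[OF assms(1,4)] by simp
qed

lemma edge_H:
  assumes "a \<in> edges H"
  shows "a \<subseteq> verts H" "card a = 2"
  using assms path_edge verts edges by fastforce+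

lemma finite_edges_H: "finite (edges H)"
proof -
  have "finite (edges (P e))" if "e \<in> edges B" for e
    using path_some[OF that] finite_edges_path_graph by metis
  then show ?thesis using finite_base_edges edges by auto
qed

text \<open>The edges of \<open>H\<close> at \<open>x\<close>.\<close>

definition incident :: "'a \<Rightarrow> 'a set set" where
  "incident x = {a \<in> edges H. x \<in> a}"

lemma finite_incident: "finite (incident x)"
  using finite_edges_H by (simp add: incident_def)

text \<open>A branch vertex \<open>b u\<close> is an end of each path \<open>P e\<close> through it and has one edge in each of them;
  any other vertex is interior to a single path.\<close>

lemma card_incident_le:
  assumes "\<And>v. card {e \<in> edges B. v \<in> e} \<le> 3"
  shows "card (incident x) \<le> 3"
proof (cases "x \<in> b ` verts B")
  case True
  then obtain u where u: "u \<in> verts B" "x = b u" by blast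
  let ?E = "{e \<in> edges B. u \<in> e}"
  have "\<forall>a\<in>incident x. \<exists>e\<in>?E. a \<in> edges (P e)"
    using branch_in_path[OF _ u(1)] path_edge(1) u(2) edges by (fastforce simp: incident_def)
  then obtain h where h: "\<And>a. a \<in> incident x \<Longrightarrow> h a \<in> ?E \<and> a \<in> edges (P (h a))" by metis
  have "inj_on h (incident x)"
  proof (rule inj_onI)
    fix a a' assume aa: "a \<in> incident x" "a' \<in> incident x" "h a = h a'"
    then obtain xs where xs: "P (h a) = path_graph xs" "distinct xs" "hd xs = b u" "length xs \<ge> 2"
      using path_at[of "h a" u] h by blast
    moreover have "x \<in> a" "x \<in> a'" using aa by (auto simp: incident_def)
    ultimately show "a = a'"
      using path_graph_end_edge[of xs a a'] h[OF aa(1)] h[OF aa(2)] aa(3) u(2) by fastforce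
  qed
  then have "card (incident x) \<le> card ?E"
    using h finite_base_edges by (intro card_inj_on_le[of h]) auto
  then show ?thesis using assms[of u] by linarith
next
  case False
  show ?thesis
  proof (cases "incident x = {}")
    case False': False
    then obtain a e where e: "e \<in> edges B" "a \<in> edges (P e)" "x \<in> a"
      using edges by (auto simp: incident_def)
    obtain xs where xs: "P e = path_graph xs" "distinct xs" using path_some[OF e(1)] .
    have "incident x \<subseteq> {a \<in> edges (P e). x \<in> a}"
    proof
      fix a' assume "a' \<in> incident x"
      then obtain f where f: "f \<in> edges B" "a' \<in> edges (P f)" "x \<in> a'"
        using edges by (auto simp: incident_def)
      have "f = e"
      proof (rule ccontr)
        assume "f \<noteq> e"
        then have "x \<in> b ` (f \<inter> e)"
          using paths_meet[OF f(1) e(1)] path_edge(1)[OF f(1,2)] path_edge(1)[OF e(1,2)] f(3) e(3)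
          by blast
        then show False using False base_edge[OF e(1)] by blast
      qed
      then show "a' \<in> {a \<in> edges (P e). x \<in> a}" using f by blast
    qed
    then have "card (incident x) \<le> card {a \<in> edges (P e). x \<in> a}"
      by (intro card_mono) (auto simp: xs(1) finite_edges_path_graph)
    then show ?thesis using path_graph_edges_at[OF xs(2), of x] xs(1) by simp
  qed simp
qed

lemma card_incident_branch:
  assumes "card {e \<in> edges B. u \<in> e} = 3"
  shows "card (incident (b u)) \<ge> 3"
proof -
  let ?E = "{e \<in> edges B. u \<in> e}"
  have "\<forall>e\<in>?E. \<exists>a\<in>edges (P e). b u \<in> a" using start_edge(1) by blast
  then obtain h where h: "\<And>e. e \<in> ?E \<Longrightarrow> h e \<in> edges (P e) \<and> b u \<in> h e" by metis
  have "inj_on h ?E"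
  proof (rule inj_onI)
    fix e f assume ef: "e \<in> ?E" "f \<in> ?E" "h e = h f"
    then show "e = f" using path_edges_disjoint[of e f "h e"] h[OF ef(1)] h[OF ef(2)] by auto
  qed
  moreover have "h e \<in> incident (b u)" if "e \<in> ?E" for e
    using h[OF that] that unfolding incident_def edges by blast
  then have "h ` ?E \<subseteq> incident (b u)" by blast
  ultimately have "card ?E \<le> card (incident (b u))"
    using card_inj_on_le[OF _ _ finite_incident] by metis
  then show ?thesis using assms by simp
qed

lemma neighbors_incident:
  "bij_betw (\<lambda>y. {x, y}) {y \<in> verts H. adj H x y} (incident x)"
proof -
  have "inj_on (\<lambda>y. {x, y}) {y \<in> verts H. adj H x y}"
    by (auto simp: inj_on_def doubleton_eq_iff)
  moreover have "a \<in> (\<lambda>y. {x, y}) ` {y \<in> verts H. adj H x y}" if a: "a \<in> incident x" for a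
  proof -
    have "card a = 2" "x \<in> a" "a \<in> edges H" "a \<subseteq> verts H" using a edge_H by (auto simp: incident_def)
    then obtain y where "a = {x, y}"
      by (metis card_2_iff doubleton_eq_iff insertE singletonD)
    then show ?thesis using \<open>a \<in> edges H\<close> \<open>a \<subseteq> verts H\<close> by (auto simp: adj_def)
  qed
  ultimately show ?thesis by (auto simp: bij_betw_def incident_def adj_def)
qed

lemma degree_H: "finite {y \<in> verts H. adj H x y}" "card {y \<in> verts H. adj H x y} = card (incident x)"
  using neighbors_incident[of x] finite_incident[of x]
  by (auto simp: bij_betw_finite dest: bij_betw_same_card)

lemma hub_H:
  assumes "card {e \<in> edges B. u \<in> e} = 3"
  shows "hub H (b u)"
proof -
  obtain e where e: "e \<in> edges B" "u \<in> e" using edge_exists_if_card_3[OF assms] .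
  then have "u \<in> verts B" using base_edge by blast
  then have "b u \<in> verts H" unfolding verts by blast
  then show ?thesis
    using card_incident_branch[OF assms] unfolding hub_def degree_H(2) by blast
qed

lemma hub_line_H:
  assumes "card {e \<in> edges B. u \<in> e} = 3" "a \<in> incident (b u)"
  shows "hub (line_graph H) a"
proof -
  have "card (incident (b u) - {a}) \<ge> 2"
    using card_incident_branch[OF assms(1)] assms(2) finite_incident by simp
  then obtain T where "T \<subseteq> incident (b u) - {a}" "card T = 2"
    by (meson obtain_subset_with_card_n)
  then obtain a2 a3 where "a2 \<noteq> a3" "a2 \<in> incident (b u) - {a}" "a3 \<in> incident (b u) - {a}"
    by (metis card_2_iff insert_subset)
  then have "a2 \<in> edges H" "a3 \<in> edges H" "a \<in> edges H" "adj (line_graph H) a a2"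
    "adj (line_graph H) a2 a3" "adj (line_graph H) a a3"
    using assms(2) by (auto simp: incident_def adj_line_graph)
  then show ?thesis unfolding hub_def by auto
qed

lemma linked_path_H:
  assumes "e \<in> edges B"
  shows "linked H (verts (P e))"
proof -
  obtain xs where xs: "P e = path_graph xs" "distinct xs" using path_some[OF assms] .
  have "linked (P e) (verts (P e))" using linked_walk[OF path_graph_walk[of xs]] xs(1) by simp
  then show ?thesis by (rule linked_mono_edges) (use assms edges in auto)
qed

text \<open>A walk of \<open>B\<close> gives linked sets in \<open>H\<close> and in the line graph of \<open>H\<close>.\<close>

lemma linked_walk_H:
  assumes "successively (adj B) p" "length p \<ge> 2"
  shows "linked H (\<Union>e\<in>edges (path_graph p). verts (P e)) \<and>
    linked (line_graph H) (\<Union>e\<in>edges (path_graph p). edges (P e))"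
  using assms
proof (induction p rule: induct_list012)
  case (3 x y zs)
  let ?V = "\<lambda>p. \<Union>e\<in>edges (path_graph p). verts (P e)"
  let ?E = "\<lambda>p. \<Union>e\<in>edges (path_graph p). edges (P e)"
  have xy: "{x, y} \<in> edges B" using 3 by (simp add: adj_def)
  have V: "linked H (verts (P {x, y}))" by (rule linked_path_H[OF xy])
  obtain xs where xs: "P {x, y} = path_graph xs" "distinct xs" using path_some[OF xy] .
  have E: "linked (line_graph H) (edges (P {x, y}))"
  proof -
    have "edges (P {x, y}) \<subseteq> edges H" unfolding edges using xy by blast
    then show ?thesis unfolding xs(1) by (rule linked_line_path[OF xs(2)])
  qed
  show ?case
  proof (cases zs)
    case Nil
    have "edges (path_graph [x, y]) = {{x, y}}" by (auto simp: path_graph_def)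
    then show ?thesis using Nil V E by simp
  next
    case (Cons z ws)
    then have IH: "linked H (?V (y # zs))" "linked (line_graph H) (?E (y # zs))"
      and yz: "{y, z} \<in> edges B" "{y, z} \<in> edges (path_graph (y # zs))"
      using 3 by (auto simp: edges_path_graph_Cons adj_def)
    have "b y \<in> verts (P {x, y})" "b y \<in> ?V (y # zs)"
      using start_edge(2)[OF xy, of y] start_edge(2)[OF yz(1), of y] yz(2) by auto
    then have "linked H (verts (P {x, y}) \<union> ?V (y # zs))"
      using linked_Un[OF V IH(1)] by blast
    moreover obtain a a' where a: "a \<in> edges (P {x, y})" "b y \<in> a" "a' \<in> edges (P {y, z})" "b y \<in> a'"
      using start_edge(1)[OF xy, of y] start_edge(1)[OF yz(1), of y] by auto
    then have "a = a' \<or> adj (line_graph H) a a'"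
      using xy yz(1) edges by (auto simp: adj_line_graph)
    then have "linked (line_graph H) (edges (P {x, y}) \<union> ?E (y # zs))"
      using linked_Un[OF E IH(2) a(1), of a'] a(3) yz(2) by blast
    ultimately show ?thesis by (simp add: edges_path_graph_Cons)
  qed
qed auto

lemma remote_H:
  assumes "remote B u v" "card {e \<in> edges B. u \<in> e} = 3" "card {e \<in> edges B. v \<in> e} = 3"
    and x: "x = b u \<or> adj H (b u) x" "x = b v \<or> adj H (b v) x"
  shows False
proof -
  have near: "\<exists>e\<in>edges B. w \<in> e \<and> x \<in> verts (P e)"
    if w: "card {e \<in> edges B. w \<in> e} = 3" "x = b w \<or> adj H (b w) x" for w
  proof -
    obtain e0 where e0: "e0 \<in> edges B" "w \<in> e0" using edge_exists_if_card_3[OF w(1)] .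
    show ?thesis
    proof (cases "x = b w")
      case True
      then show ?thesis using e0 start_edge(2) by blast
    next
      case False
      then obtain e where e: "e \<in> edges B" "{b w, x} \<in> edges (P e)"
        using w(2) edges by (auto simp: adj_def)
      then have "b w \<in> verts (P e)" "x \<in> verts (P e)" using path_edge(1) by blast+
      then show ?thesis using branch_in_path[OF e(1)] e e0 base_edge by blast
    qed
  qed
  obtain e f where ef: "e \<in> edges B" "u \<in> e" "x \<in> verts (P e)" "f \<in> edges B" "v \<in> f" "x \<in> verts (P f)"
    using near[OF assms(2) x(1)] near[OF assms(3) x(2)] by blast
  then have "e \<inter> f \<noteq> {}" using paths_meet_ends by blast
  then show False using assms(1) ef unfolding remote_def by (metis Int_commute Int_absorb empty_iff)
qed

lemma remote_line_H:
  assumes "remote B u v" and e: "e \<in> edges B" "u \<in> e" "a \<in> edges (P e)"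
    and f: "f \<in> edges B" "v \<in> f" "a' \<in> edges (P f)"
    and x: "x = a \<or> adj (line_graph H) a x" "x = a' \<or> adj (line_graph H) a' x"
  shows False
proof -
  have x': "x \<in> edges H" "a \<inter> x \<noteq> {}" "a' \<inter> x \<noteq> {}"
    using x path_edge(3,4)[OF e(1,3)] path_edge(3,4)[OF f(1,3)] by (auto simp: adj_line_graph)
  then obtain g where g: "g \<in> edges B" "x \<in> edges (P g)" using edges by auto
  have "e \<inter> g \<noteq> {}" "f \<inter> g \<noteq> {}"
    using x'(2,3) paths_meet_ends[OF e(1) g(1)] paths_meet_ends[OF f(1) g(1)]
      path_edge(1)[OF e(1,3)] path_edge(1)[OF f(1,3)] path_edge(1)[OF g] by blast+
  then show False using assms(1) e f g unfolding remote_def by blast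
qed

text \<open>The six walks of \<open>B\<close> give six linked sets of vertices in \<open>H\<close> and six linked sets of edges,
  which are sets of vertices of the line graph.  A closed neighborhood in the line graph consists of
  the edges at the two ends of one edge, which is counted twice, so it has at most
  \<open>3 + 3 - 1 = 5\<close> elements.\<close>

lemma not_separable:
  assumes B: "has_six_paths B"
  shows "\<not> separable H S" "\<not> separable (line_graph H) S'"
proof -
  have deg: "\<And>x. card (incident x) \<le> 3"
    using card_incident_le B by (simp add: has_six_paths_def)
  from B obtain p :: "nat \<Rightarrow> 'b list" where
    p': "\<forall>i<6. p i \<noteq> [] \<and> successively (adj B) (p i) \<and> remote B (hd (p i)) (last (p i)) \<and>
           card {e \<in> edges B. hd (p i) \<in> e} = 3 \<and> card {e \<in> edges B. last (p i) \<in> e} = 3"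
    and disj: "\<forall>i<6. \<forall>j<6. i \<noteq> j \<longrightarrow> set (p i) \<inter> set (p j) = {}"
    unfolding has_six_paths_def by (elim conjE exE)
  have p: "p i \<noteq> []" "successively (adj B) (p i)" "remote B (hd (p i)) (last (p i))"
      "card {e \<in> edges B. hd (p i) \<in> e} = 3" "card {e \<in> edges B. last (p i) \<in> e} = 3"
    if "i < 6" for i
    using p'[rule_format, OF that] by simp_all
  let ?F = "\<lambda>i. edges (path_graph (p i))"
  have len: "length (p i) \<ge> 2" if i: "i < 6" for i
  proof (rule ccontr)
    assume "\<not> length (p i) \<ge> 2"
    moreover have "length (p i) \<noteq> 0" using p(1)[OF i] by simp
    ultimately have "length (p i) = Suc 0" by linarith
    then have "hd (p i) = last (p i)" by (auto simp: length_Suc_conv)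
    moreover obtain e where "e \<in> edges B" "hd (p i) \<in> e"
      using edge_exists_if_card_3[OF p(4)[OF i]] .
    ultimately show False using p(3)[OF i] unfolding remote_def by (metis disjoint_iff)
  qed
  have FB: "?F i \<subseteq> edges B" if "i < 6" for i
    using p(2)[OF that] unfolding path_graph_def successively_conv_nth adj_def by auto
  have Fp: "e \<subseteq> set (p i)" if "e \<in> ?F i" for e i using that by (auto simp: path_graph_def)
  have disjF: "e \<inter> f = {}" if "i < 6" "j < 6" "i \<noteq> j" "e \<in> ?F i" "f \<in> ?F j" for i j e f
    using Fp[OF that(4)] Fp[OF that(5)] disj[rule_format, OF that(1-3)] by blast
  have disjV: "verts (P e) \<inter> verts (P f) = {}" if "i < 6" "j < 6" "i \<noteq> j" "e \<in> ?F i" "f \<in> ?F j" for i j e f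
  proof -
    have "e \<in> edges B" "f \<in> edges B" using FB[OF that(1)] FB[OF that(2)] that(4,5) by blast+
    then show ?thesis using paths_meet_ends disjF[OF that] by blast
  qed
  have ends: "\<exists>e\<in>?F i. hd (p i) \<in> e" "\<exists>e\<in>?F i. last (p i) \<in> e" if i: "i < 6" for i
  proof -
    have "hd (p i) \<in> {p i ! 0, p i ! Suc 0}" using p(1)[OF i] by (simp add: hd_conv_nth)
    moreover have "{p i ! 0, p i ! Suc 0} \<in> ?F i"
      using len[OF i] by (intro path_graph_edgeI) simp
    ultimately show "\<exists>e\<in>?F i. hd (p i) \<in> e" by (rule bexI)
    define m where "m = length (p i) - 2"
    have m: "Suc m < length (p i)" "length (p i) - 1 = Suc m" using len[OF i] by (auto simp: m_def)
    then have "last (p i) \<in> {p i ! m, p i ! Suc m}" using p(1)[OF i] by (simp add: last_conv_nth)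
    moreover have "{p i ! m, p i ! Suc m} \<in> ?F i" by (rule path_graph_edgeI[OF m(1)])
    ultimately show "\<exists>e\<in>?F i. last (p i) \<in> e" by (rule bexI)
  qed
  show "\<not> separable H S"
  proof (rule not_separable_six_hub_pairs[where A = "\<lambda>i. \<Union>e\<in>?F i. verts (P e)"])
    show "finite {u \<in> verts H. adj H v u} \<and> card (insert v {u \<in> verts H. adj H v u}) \<le> 5" for v
      using degree_H[of v] deg[of v] by (simp add: card_insert_if)
    fix i :: nat assume i: "i < 6"
    show "(\<Union>e\<in>?F i. verts (P e)) \<subseteq> verts H \<and> linked H (\<Union>e\<in>?F i. verts (P e))"
      using FB[OF i] verts linked_walk_H[OF p(2)[OF i] len[OF i]] by auto
    obtain e f where e: "e \<in> ?F i" "hd (p i) \<in> e" and f: "f \<in> ?F i" "last (p i) \<in> f"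
      using ends[OF i] by blast
    have eB: "e \<in> edges B" and fB: "f \<in> edges B" using e f FB[OF i] by auto
    have "b (hd (p i)) \<in> (\<Union>e\<in>?F i. verts (P e))" "b (last (p i)) \<in> (\<Union>e\<in>?F i. verts (P e))"
      using start_edge(2)[OF eB e(2)] start_edge(2)[OF fB f(2)] e(1) f(1) by blast+
    then show "\<exists>u\<in>\<Union>e\<in>?F i. verts (P e). \<exists>w\<in>\<Union>e\<in>?F i. verts (P e). hub H u \<and> hub H w \<and>
        \<not> (\<exists>x. (x = u \<or> adj H u x) \<and> (x = w \<or> adj H w x))"
      using hub_H[OF p(4)[OF i]] hub_H[OF p(5)[OF i]] remote_H[OF p(3)[OF i] p(4)[OF i] p(5)[OF i]]
      by metis
  next
    fix i j :: nat assume "i < 6" "j < 6" "i \<noteq> j"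
    then show "(\<Union>e\<in>?F i. verts (P e)) \<inter> (\<Union>e\<in>?F j. verts (P e)) = {}"
      using disjV by blast
  qed
  show "\<not> separable (line_graph H) S'"
  proof (rule not_separable_six_hub_pairs[where A = "\<lambda>i. \<Union>e\<in>?F i. edges (P e)"])
    let ?L = "line_graph H"
    fix a assume "a \<in> verts ?L"
    then have a: "a \<in> edges H" by simp
    then obtain x y where xy: "a = {x, y}" using edge_H(2) by (meson card_2_iff)
    have sub: "insert a {u \<in> verts ?L. adj ?L a u} \<subseteq> incident x \<union> incident y"
      using a by (auto simp: adj_line_graph incident_def xy)
    have "a \<in> incident x \<inter> incident y" using a xy by (auto simp: incident_def)
    then have "card (incident x \<inter> incident y) \<noteq> 0" using finite_incident by auto
    moreover have "card (incident x) + card (incident y) =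
        card (incident x \<union> incident y) + card (incident x \<inter> incident y)"
      by (rule card_Un_Int) (rule finite_incident)+
    ultimately have "card (incident x \<union> incident y) \<le> 5" using deg[of x] deg[of y] by linarith
    moreover have fin: "finite (incident x \<union> incident y)" using finite_incident by simp
    ultimately show "finite {u \<in> verts ?L. adj ?L a u} \<and>
        card (insert a {u \<in> verts ?L. adj ?L a u}) \<le> 5"
      using card_mono[OF fin sub] finite_subset[OF sub fin] by auto
  next
    let ?L = "line_graph H"
    fix i :: nat assume i: "i < 6"
    show "(\<Union>e\<in>?F i. edges (P e)) \<subseteq> verts ?L \<and> linked ?L (\<Union>e\<in>?F i. edges (P e))"
      using FB[OF i] edges linked_walk_H[OF p(2)[OF i] len[OF i]] by auto
    obtain e f where e: "e \<in> ?F i" "hd (p i) \<in> e" and f: "f \<in> ?F i" "last (p i) \<in> f"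
      using ends[OF i] by blast
    have eB: "e \<in> edges B" and fB: "f \<in> edges B" using e f FB[OF i] by auto
    obtain a a' where a: "a \<in> edges (P e)" "b (hd (p i)) \<in> a"
      and a': "a' \<in> edges (P f)" "b (last (p i)) \<in> a'"
      using start_edge(1)[OF eB e(2)] start_edge(1)[OF fB f(2)] by blast
    have "a \<in> incident (b (hd (p i)))" "a' \<in> incident (b (last (p i)))"
      using a a' path_edge(3) eB fB by (auto simp: incident_def)
    then have hubs: "hub ?L a" "hub ?L a'" using hub_line_H p(4,5) i by blast+
    have "\<not> (\<exists>x. (x = a \<or> adj ?L a x) \<and> (x = a' \<or> adj ?L a' x))"
      using remote_line_H[OF p(3)[OF i] eB e(2) a(1) fB f(2) a'(1)] by blast
    then show "\<exists>u\<in>\<Union>e\<in>?F i. edges (P e). \<exists>w\<in>\<Union>e\<in>?F i. edges (P e). hub ?L u \<and> hub ?L w \<and>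
        \<not> (\<exists>x. (x = u \<or> adj ?L u x) \<and> (x = w \<or> adj ?L w x))"
      using hubs a(1) a'(1) e(1) f(1) by blast
  next
    fix i j :: nat assume ij: "i < 6" "j < 6" "i \<noteq> j"
    show "(\<Union>e\<in>?F i. edges (P e)) \<inter> (\<Union>e\<in>?F j. edges (P e)) = {}"
    proof (rule ccontr)
      assume "\<not> ?thesis"
      then obtain e f a where "e \<in> ?F i" "f \<in> ?F j" "a \<in> edges (P e)" "a \<in> edges (P f)" by blast
      moreover from this have "e \<in> edges B" "f \<in> edges B" using FB ij by auto
      ultimately show False using disjV[OF ij, of e f] path_edge(1,4) by blast
    qed
  qed
qed

end

lemma subdivision_not_separable:
  assumes "has_six_paths B" "subdivision_of H B"
  shows "\<not> separable H S" "\<not> separable (line_graph H) S'"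
proof -
  from assms(2) obtain b P where "inj_on b (verts B)"
      "\<forall>u v. {u, v} \<in> edges B \<longrightarrow>
           path_between (P {u, v}) (b u) (b v) \<and> path_length (P {u, v}) \<ge> 1"
      "\<forall>e\<in>edges B. (verts (P e) - b ` e) \<inter> b ` verts B = {}"
      "\<forall>e\<in>edges B. \<forall>f\<in>edges B. e \<noteq> f \<longrightarrow>
           (verts (P e) - b ` e) \<inter> (verts (P f) - b ` f) = {}"
      "verts H = b ` verts B \<union> (\<Union>e\<in>edges B. verts (P e))"
      "edges H = (\<Union>e\<in>edges B. edges (P e))"
    unfolding subdivision_of_def by (elim exE conjE)
  moreover have "simple_graph B" using assms(1) by (simp add: has_six_paths_def)
  ultimately interpret subdivided_graph H B b P by unfold_locales simp_all
  show "\<not> separable H S" "\<not> separable (line_graph H) S'"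
    using not_separable[OF assms(1)] .
qed

section \<open>The binary tree and the wall\<close>

lemma edges_binary_tree: "edges (binary_tree r) = {{xs, c # xs} | xs c. length xs < r}"
  by (simp add: binary_tree_def)

lemma binary_tree_edgeI: "length v < r \<Longrightarrow> {v, c # v} \<in> edges (binary_tree r)"
  by (auto simp: edges_binary_tree)

lemma binary_tree_edges_at:
  "{e \<in> edges (binary_tree r). v \<in> e} \<subseteq> {{v, True # v}, {v, False # v}, {tl v, v}}"
proof
  fix e assume "e \<in> {e \<in> edges (binary_tree r). v \<in> e}"
  then obtain xs c where "e = {xs, c # xs}" "v \<in> {xs, c # xs}"
    by (auto simp: edges_binary_tree)
  then show "e \<in> {{v, True # v}, {v, False # v}, {tl v, v}}"
    by (cases c) auto
qed

lemma card_binary_tree_edges_at: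
  assumes "0 < length v" "length v < r"
  shows "card {e \<in> edges (binary_tree r). v \<in> e} = 3"
proof -
  obtain c w where v: "v = c # w" using assms(1) by (cases v) auto
  have "{v, True # v} \<in> edges (binary_tree r)" "{v, False # v} \<in> edges (binary_tree r)"
    "{tl v, v} \<in> edges (binary_tree r)"
    using assms(2) binary_tree_edgeI[of v r] binary_tree_edgeI[of w r c] by (simp_all add: v)
  then have eq: "{e \<in> edges (binary_tree r). v \<in> e} = {{v, True # v}, {v, False # v}, {tl v, v}}"
    using binary_tree_edges_at[of r v] by auto
  have "w \<noteq> a # c # w" for a
  proof
    assume "w = a # c # w"
    then have "length w = length (a # c # w)" by (rule arg_cong)
    then show False by simp
  qed
  then show ?thesis unfolding eq unfolding v by (simp add: doubleton_eq_iff)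
qed

lemma simple_binary_tree: "simple_graph (binary_tree r)"
proof -
  have "finite {xs :: bool list. length xs \<le> r}"
    using finite_lists_length_le[of "UNIV :: bool set" r] by simp
  then show ?thesis by (auto simp: simple_graph_def binary_tree_def)
qed

text \<open>Below each vertex \<open>w\<close> at depth three there is a path of length four with middle vertex \<open>w\<close>.
  Its ends, at depth five, have degree three.\<close>

lemma has_six_paths_binary_tree: "has_six_paths (binary_tree 7)"
proof -
  let ?B = "binary_tree 7"
  define ws where "ws = [[False, False, False], [False, False, True], [False, True, False],
    [False, True, True], [True, False, False], [True, False, True]]"
  have ws: "distinct ws" "length ws = 6" "\<forall>w\<in>set ws. length w = 3" by (auto simp: ws_def)
  define p where "p i = (let w = ws ! i in [False # False # w, False # w, w, True # w, True # True # w])" for i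
  define suf where "suf k v = drop (length v - k) v" for k and v :: "bool list"
  have suf_Cons: "suf k (c # v) = suf k v" if "length v \<ge> k" for k c v
    using that by (simp add: suf_def Suc_diff_le)
  have suf_self: "suf k v = v" if "length v = k" for k v using that by (simp add: suf_def)
  have w3: "length (ws ! i) = 3" if "i < 6" for i using ws that by simp
  have deg: "card {e \<in> edges ?B. v \<in> e} \<le> 3" for v
  proof -
    have "card {e \<in> edges ?B. v \<in> e} \<le> card {{v, True # v}, {v, False # v}, {tl v, v}}"
      by (rule card_mono[OF _ binary_tree_edges_at]) simp
    also have "\<dots> \<le> 3" by (simp add: card_insert_if)
    finally show ?thesis .
  qed
  \<comment> \<open>\<open>suf k v\<close> is the ancestor of \<open>v\<close> at depth \<open>k\<close>; the ends of an edge at \<open>c # c # w\<close> are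
    \<open>c # w\<close> or descendants of it\<close>
  have near: "suf 4 y = c # w \<and> length y \<ge> 4"
    if "length w = 3" "e \<in> edges ?B" "c # c # w \<in> e" "y \<in> e" for c w e y
  proof -
    have "e \<in> {{c # c # w, True # c # c # w}, {c # c # w, False # c # c # w}, {c # w, c # c # w}}"
      using binary_tree_edges_at[of 7 "c # c # w"] that by auto
    then have "y \<in> {c # w, c # c # w, True # c # c # w, False # c # c # w}" using that(4) by auto
    then show ?thesis using that(1) by (auto simp: suf_Cons suf_self)
  qed
  have remote: "remote ?B (False # False # w) (True # True # w)" if w: "length w = 3" for w
    unfolding remote_def
  proof clarify
    fix e f g assume e: "e \<in> edges ?B" "False # False # w \<in> e" "e \<inter> g \<noteq> {}"
      and f: "f \<in> edges ?B" "True # True # w \<in> f" "f \<inter> g \<noteq> {}" and g: "g \<in> edges ?B"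
    obtain y z where yz: "y \<in> e" "y \<in> g" "z \<in> f" "z \<in> g" using e f by blast
    have y: "suf 4 y = False # w" "length y \<ge> 4" using near[OF w e(1,2) yz(1)] by auto
    have z: "suf 4 z = True # w" "length z \<ge> 4" using near[OF w f(1,2) yz(3)] by auto
    obtain xs c where "g = {xs, c # xs}" using g by (auto simp: edges_binary_tree)
    then have "y = z \<or> y = c # z \<or> z = c # y" using yz by auto
    then show False using y z suf_Cons by auto
  qed
  have hubs: "card {e \<in> edges ?B. c # c # w \<in> e} = 3" if "length w = 3" for c w
    using that by (intro card_binary_tree_edges_at) auto
  have walk: "successively (adj ?B) (p i)" if "i < 6" for i
  proof -
    have step: "adj ?B v (c # v)" "adj ?B (c # v) v" if "length v < 7" for c v
      using binary_tree_edgeI[OF that] by (simp_all add: adj_def insert_commute)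
    show ?thesis using w3[OF that] by (simp add: p_def Let_def step)
  qed
  have disj: "set (p i) \<inter> set (p j) = {}" if "i < 6" "j < 6" "i \<noteq> j" for i j
  proof -
    have "suf 3 x = ws ! k" if "k < 6" "x \<in> set (p k)" for k x
      using that w3[OF that(1)] by (auto simp: p_def Let_def suf_Cons suf_self)
    moreover have "ws ! i \<noteq> ws ! j" using ws that by (simp add: nth_eq_iff_index_eq)
    ultimately show ?thesis using that by (metis disjoint_iff)
  qed
  have "p i \<noteq> []" "hd (p i) = False # False # ws ! i" "last (p i) = True # True # ws ! i" for i
    by (simp_all add: p_def Let_def)
  then have ex: "\<forall>i<6. p i \<noteq> [] \<and> successively (adj ?B) (p i) \<and> remote ?B (hd (p i)) (last (p i)) \<and>
      card {e \<in> edges ?B. hd (p i) \<in> e} = 3 \<and> card {e \<in> edges ?B. last (p i) \<in> e} = 3"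
    using walk remote w3 hubs by simp
  show ?thesis unfolding has_six_paths_def
    by (intro conjI allI exI[of _ p]) (use simple_binary_tree deg ex disj in auto)
qed

lemma edges_uncropped_wall: "edges (uncropped_wall r) =
    {{(i, j), (i, j + 1)} | i j. 1 \<le> i \<and> i \<le> r \<and> 1 \<le> j \<and> j < 2 * r}
    \<union> {{(i, j), (i + 1, j)} | i j. 1 \<le> i \<and> i < r \<and> 1 \<le> j \<and> j \<le> 2 * r \<and> even (i + j)}"
  and verts_uncropped_wall: "verts (uncropped_wall r) = {1..r} \<times> {1..2 * r}"
  by (simp_all add: uncropped_wall_def)

lemma uncropped_wall_edgeE:
  assumes "e \<in> edges (uncropped_wall r)"
  obtains (horizontal) i j where "e = {(i, j), (i, j + 1)}" "1 \<le> i" "i \<le> r" "1 \<le> j" "j < 2 * r"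
    | (vertical) i j where "e = {(i, j), (i + 1, j)}" "1 \<le> i" "i < r" "1 \<le> j" "j \<le> 2 * r"
      "even (i + j)"
  using assms unfolding edges_uncropped_wall by blast

lemma simple_uncropped_wall: "simple_graph (uncropped_wall r)"
  unfolding simple_graph_def
proof (intro conjI ballI)
  show "finite (verts (uncropped_wall r))" by (simp add: verts_uncropped_wall)
  fix e assume "e \<in> edges (uncropped_wall r)"
  then show "e \<subseteq> verts (uncropped_wall r)" "card e = 2"
    by (cases rule: uncropped_wall_edgeE; simp add: verts_uncropped_wall)+
qed

text \<open>Every vertex has at most one vertical edge, whose direction depends on the parity of
  \<open>i + j\<close>.\<close>

lemma uncropped_wall_edges_at:
  "{e \<in> edges (uncropped_wall r). (i, j) \<in> e} \<subseteq>
     {{(i, j - 1), (i, j)}, {(i, j), (i, j + 1)},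
      if even (i + j) then {(i, j), (i + 1, j)} else {(i - 1, j), (i, j)}}"
  (is "_ \<subseteq> ?E")
proof
  fix e assume "e \<in> {e \<in> edges (uncropped_wall r). (i, j) \<in> e}"
  then have "e \<in> edges (uncropped_wall r)" "(i, j) \<in> e" by auto
  then consider (hor) k l where "e = {(k, l), (k, l + 1)}"
    | (ver) k l where "e = {(k, l), (k + 1, l)}" "even (k + l)"
    by (elim uncropped_wall_edgeE) blast+
  then show "e \<in> ?E"
  proof cases
    case hor
    then consider "k = i" "l = j" | "k = i" "j = l + 1" using \<open>(i, j) \<in> e\<close> by auto
    then show ?thesis by cases (simp_all add: hor)
  next
    case ver
    then consider "k = i" "l = j" | "i = k + 1" "l = j" using \<open>(i, j) \<in> e\<close> by auto
    then show ?thesis by cases (use ver in simp_all)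
  qed
qed

lemma uncropped_wall_columns:
  assumes "e \<in> edges (uncropped_wall r)" "x \<in> e" "y \<in> e"
  shows "snd x \<le> snd y + 1"
  using assms by (auto elim!: uncropped_wall_edgeE)

text \<open>Only vertices of degree one are removed from the uncropped wall, so a vertex with neighbors
  on both sides in its row remains.\<close>

lemma edges_wall: "edges (wall r) =
    {e \<in> edges (uncropped_wall r). \<forall>v\<in>e. degree (uncropped_wall r) v \<noteq> 1}"
  using simple_uncropped_wall[of r]
  by (auto simp: wall_def delete_verts_def induced_def simple_graph_def)

lemma uncropped_wall_degree:
  assumes "1 \<le> i" "i \<le> r" "1 < j" "j < 2 * r"
  shows "degree (uncropped_wall r) (i, j) \<noteq> 1"
proof -
  let ?U = "uncropped_wall r"
  have "{(i, j - 1), (i, (j - 1) + 1)} \<in> edges ?U"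
    unfolding edges_uncropped_wall using assms by (intro UnI1 CollectI exI conjI) (rule refl, auto)
  moreover have "{(i, j), (i, j + 1)} \<in> edges ?U"
    unfolding edges_uncropped_wall using assms by (intro UnI1 CollectI exI conjI) (rule refl, auto)
  ultimately have sub: "{(i, j - 1), (i, j + 1)} \<subseteq> {u \<in> verts ?U. adj ?U (i, j) u}"
    using assms by (auto simp: adj_def insert_commute verts_uncropped_wall)
  have "card {(i, j - 1), (i, j + 1)} \<le> degree ?U (i, j)"
    unfolding degree_def by (rule card_mono[OF _ sub]) (simp add: verts_uncropped_wall)
  then show ?thesis using assms by (simp add: card_insert_if)
qed

lemma wall_edgeI:
  assumes "1 \<le> i" "i \<le> r" "1 < j" "j + 1 < 2 * r"
  shows "{(i, j), (i, j + 1)} \<in> edges (wall r)"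
proof -
  have "{(i, j), (i, j + 1)} \<in> edges (uncropped_wall r)"
    unfolding edges_uncropped_wall using assms by (intro UnI1 CollectI exI conjI) (rule refl, auto)
  then show ?thesis using assms uncropped_wall_degree by (auto simp: edges_wall)
qed

lemma wall_vertical_edgeI:
  assumes "1 \<le> i" "i < r" "1 < j" "j < 2 * r" "even (i + j)"
  shows "{(i, j), (i + 1, j)} \<in> edges (wall r)"
proof -
  have "{(i, j), (i + 1, j)} \<in> edges (uncropped_wall r)"
    unfolding edges_uncropped_wall using assms by (intro UnI2 CollectI exI conjI) (rule refl, auto)
  then show ?thesis using assms uncropped_wall_degree by (auto simp: edges_wall)
qed

text \<open>In an odd column the vertical edges join rows \<open>i\<close> and \<open>i + 1\<close> for odd \<open>i\<close>.  Hence for even \<open>r\<close>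
  they cover every row, including the first and the last.\<close>

lemma card_wall_edges_at:
  assumes "even r" "1 \<le> i" "i \<le> r" "2 < j" "j + 1 < 2 * r" "odd j"
  shows "card {e \<in> edges (wall r). (i, j) \<in> e} = 3"
proof -
  define e where "e = (if even (i + j) then {(i, j), (i + 1, j)} else {(i - 1, j), (i, j)})"
  have e: "e \<in> edges (wall r)"
  proof (cases "even (i + j)")
    case True
    then have "i \<noteq> r" using assms by auto
    then show ?thesis using True wall_vertical_edgeI[of i r j] assms by (simp add: e_def)
  next
    case False
    then have "even i" using assms(6) by simp
    then have "i \<noteq> 1" by auto
    then obtain m where m: "i = Suc m" "1 \<le> m" using assms(2) by (cases i) auto
    have "even (m + j)" using False m(1) by simp
    then have "{(m, j), (m + 1, j)} \<in> edges (wall r)"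
      using wall_vertical_edgeI[of m r j] assms(3-5) m by simp
    then show ?thesis using False m(1) by (simp add: e_def)
  qed
  have h: "{(i, j - 1), (i, j)} \<in> edges (wall r)" "{(i, j), (i, j + 1)} \<in> edges (wall r)"
    using wall_edgeI[of i r "j - 1"] wall_edgeI[of i r j] assms by simp_all
  have "{e \<in> edges (wall r). (i, j) \<in> e} \<subseteq> {{(i, j - 1), (i, j)}, {(i, j), (i, j + 1)}, e}"
    using uncropped_wall_edges_at[of r i j] unfolding e_def edges_wall by blast
  moreover have "(i, j) \<in> e" by (simp add: e_def)
  ultimately have eq: "{e \<in> edges (wall r). (i, j) \<in> e} = {{(i, j - 1), (i, j)}, {(i, j), (i, j + 1)}, e}"
    using e h by blast
  have "(i + 1, j) \<in> e \<or> (i - 1, j) \<in> e \<and> i - 1 \<noteq> i" using assms(2) by (auto simp: e_def)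
  then have "e \<noteq> {(i, j - 1), (i, j)}" "e \<noteq> {(i, j), (i, j + 1)}" by auto
  moreover have "{(i, j - 1), (i, j)} \<noteq> {(i, j), (i, j + 1)}" by (simp add: doubleton_eq_iff)
  ultimately show ?thesis unfolding eq by (simp add: card_insert_if)
qed

text \<open>In each of the six rows take the part between columns \<open>3\<close> and \<open>9\<close>.\<close>

lemma has_six_paths_wall: "has_six_paths (wall 6)"
proof -
  let ?B = "wall 6"
  have sub: "edges ?B \<subseteq> edges (uncropped_wall 6)" by (auto simp: edges_wall)
  have "verts ?B \<subseteq> verts (uncropped_wall 6)" by (auto simp: wall_def)
  moreover have "e \<subseteq> verts ?B" if "e \<in> edges ?B" for e
    using that by (auto simp: wall_def delete_verts_def induced_def)
  ultimately have simple: "simple_graph ?B"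
    using simple_uncropped_wall[of 6] sub by (auto simp: simple_graph_def intro: finite_subset)
  have deg: "card {e \<in> edges ?B. v \<in> e} \<le> 3" for v
  proof -
    obtain i j where v: "v = (i, j)" by (cases v)
    let ?E = "{{(i, j - 1), (i, j)}, {(i, j), (i, j + 1)},
      if even (i + j) then {(i, j), (i + 1, j)} else {(i - 1, j), (i, j)}}"
    have "{e \<in> edges ?B. v \<in> e} \<subseteq> ?E" using uncropped_wall_edges_at[of 6 i j] sub v by blast
    then have "card {e \<in> edges ?B. v \<in> e} \<le> card ?E" by (rule card_mono[rotated]) simp
    also have "\<dots> \<le> 3" by (simp add: card_insert_if)
    finally show ?thesis .
  qed
  define p :: "nat \<Rightarrow> (nat \<times> nat) list" where "p i = map (\<lambda>j. (Suc i, j)) [3..<10]" for i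
  have p: "p i \<noteq> []" "hd (p i) = (Suc i, 3)" "last (p i) = (Suc i, 9)" for i
    by (simp_all add: p_def upt_rec)
  have walk: "successively (adj ?B) (p i)" if "i < 6" for i
  proof (subst successively_conv_nth, intro allI impI)
    fix k assume "Suc k < length (p i)"
    then have k: "k < 6" by (simp add: p_def)
    then have "p i ! k = (Suc i, k + 3)" "p i ! Suc k = (Suc i, k + 3 + 1)"
      by (simp_all add: p_def del: upt_rec_numeral)
    with k show "adj ?B (p i ! k) (p i ! Suc k)"
      using wall_edgeI[of "Suc i" 6 "k + 3"] that by (simp add: adj_def)
  qed
  have remote: "remote ?B (i, 3) (i, 9)" for i
    unfolding remote_def
  proof clarify
    fix e f g assume e: "e \<in> edges ?B" "(i, 3) \<in> e" "e \<inter> g \<noteq> {}"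
      and f: "f \<in> edges ?B" "(i, 9) \<in> f" "f \<inter> g \<noteq> {}" and g: "g \<in> edges ?B"
    obtain y z where yz: "y \<in> e" "y \<in> g" "z \<in> f" "z \<in> g" using e f by blast
    have U: "e \<in> edges (uncropped_wall 6)" "f \<in> edges (uncropped_wall 6)" "g \<in> edges (uncropped_wall 6)"
      using e(1) f(1) g sub by blast+
    show False
      using uncropped_wall_columns[OF U(1) yz(1) e(2)] uncropped_wall_columns[OF U(2) f(2) yz(3)]
        uncropped_wall_columns[OF U(3) yz(4,2)] by simp
  qed
  have hubs: "card {e \<in> edges ?B. (Suc i, 3) \<in> e} = 3" "card {e \<in> edges ?B. (Suc i, 9) \<in> e} = 3"
    if "i < 6" for i
    using that by (auto intro!: card_wall_edges_at)
  have ex: "\<forall>i<6. p i \<noteq> [] \<and> successively (adj ?B) (p i) \<and> remote ?B (hd (p i)) (last (p i)) \<and>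
      card {e \<in> edges ?B. hd (p i) \<in> e} = 3 \<and> card {e \<in> edges ?B. last (p i) \<in> e} = 3"
    using walk remote hubs p by simp
  have disj: "\<forall>i<6. \<forall>j<6. i \<noteq> j \<longrightarrow> set (p i) \<inter> set (p j) = {}" by (auto simp: p_def)
  show ?thesis unfolding has_six_paths_def
    by (intro conjI allI exI[of _ p]) (use simple deg ex disj in auto)
qed

section \<open>Zigzagged constellations\<close>

lemma component_disjoint:
  assumes "L \<in> components G" "L' \<in> components G" "v \<in> verts L" "v \<in> verts L'"
  shows "L = L'"
  using component_eq assms by metis

lemma constellation_path_linked:
  assumes "constellation d T" "L \<in> components (delete_verts d T)"
  shows "linked d (verts L)" "verts L \<subseteq> verts d - T"
proof -
  obtain xs where xs: "L = path_graph xs"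
    using assms unfolding constellation_def is_path_def path_between_def by blast
  have "linked L (verts L)" using linked_walk[OF path_graph_walk[of xs]] xs by simp
  moreover have "edges L \<subseteq> edges d"
    using component_edges[OF assms(2)] by (auto simp: delete_verts_def induced_def)
  ultimately show "linked d (verts L)" by (rule linked_mono_edges)
  show "verts L \<subseteq> verts d - T" using component_subset[OF assms(2)] by simp
qed

lemma constellation_degree:
  assumes d: "constellation d T" and t: "t \<in> T"
  shows "card (components (delete_verts d T)) \<le> card {u \<in> verts d. adj d t u}"
proof -
  let ?C = "components (delete_verts d T)"
  have "\<forall>L\<in>?C. \<exists>v\<in>verts L. adj d t v" using d t unfolding constellation_def by blast
  then obtain h where h: "\<And>L. L \<in> ?C \<Longrightarrow> h L \<in> verts L \<and> adj d t (h L)" by metis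
  have "inj_on h ?C"
  proof (rule inj_onI)
    fix L L' assume L: "L \<in> ?C" "L' \<in> ?C" "h L = h L'"
    then show "L = L'" using component_disjoint[OF L(1,2), of "h L"] h[OF L(1)] h[OF L(2)] by simp
  qed
  moreover have "h ` ?C \<subseteq> {u \<in> verts d. adj d t u}"
    using h constellation_path_linked(2)[OF d] by blast
  moreover have "finite {u \<in> verts d. adj d t u}"
    using d by (simp add: constellation_def simple_graph_def)
  ultimately show ?thesis by (rule card_inj_on_le)
qed

text \<open>If fewer than \<open>q\<close> elements lie strictly between \<open>k\<close> and any other element, then at most \<open>q\<close>
  elements precede \<open>k\<close> and at most \<open>q\<close> follow it.\<close>

lemma linear_order_card_le:
  assumes r: "linear_order_on T r" and fin: "finite T" and k: "k \<in> T"
    and between: "\<And>x. x \<in> T \<Longrightarrow> x \<noteq> k \<Longrightarrow>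
      card {z \<in> T. z \<noteq> x \<and> z \<noteq> k \<and> ((x, z) \<in> r \<and> (z, k) \<in> r \<or> (k, z) \<in> r \<and> (z, x) \<in> r)} < q"
  shows "card T \<le> 2 * q + 1"
proof -
  let ?B = "\<lambda>x. {z \<in> T. z \<noteq> x \<and> z \<noteq> k \<and> ((x, z) \<in> r \<and> (z, k) \<in> r \<or> (k, z) \<in> r \<and> (z, x) \<in> r)}"
  let ?lo = "{z \<in> T. z \<noteq> k \<and> (z, k) \<in> r}"
  let ?hi = "{z \<in> T. z \<noteq> k \<and> (k, z) \<in> r}"
  have lo: "card ?lo \<le> q"
  proof (cases "?lo = {}")
    case True
    show ?thesis unfolding True by simp
  next
    case False
    then obtain m where m: "m \<in> ?lo" "\<forall>a\<in>?lo. (m, a) \<in> r"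
      using linear_order_min[OF r, of ?lo] fin by auto
    have "card (?lo - {m}) \<le> card (?B m)"
      by (rule card_mono) (use fin m in auto)
    also have "\<dots> < q" using between m(1) by blast
    finally show ?thesis using m(1) fin by (simp add: card_Diff_singleton)
  qed
  have hi: "card ?hi \<le> q"
  proof (cases "?hi = {}")
    case True
    show ?thesis unfolding True by simp
  next
    case False
    then obtain m where m: "m \<in> ?hi" "\<forall>a\<in>?hi. (a, m) \<in> r"
      using linear_order_max[OF r, of ?hi] fin by auto
    have "card (?hi - {m}) \<le> card (?B m)"
      by (rule card_mono) (use fin m in auto)
    also have "\<dots> < q" using between m(1) by blast
    finally show ?thesis using m(1) fin by (simp add: card_Diff_singleton)
  qed
  have "T \<subseteq> insert k (?lo \<union> ?hi)"
    using r k by (auto simp: order_on_defs total_on_def)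
  then have "card T \<le> card (insert k (?lo \<union> ?hi))"
    by (rule card_mono[rotated]) (use fin in simp)
  also have "\<dots> \<le> Suc (card (?lo \<union> ?hi))" by (rule card_insert_le_m1) simp_all
  also have "\<dots> \<le> Suc (card ?lo + card ?hi)" using card_Un_le by auto
  finally show ?thesis using lo hi by simp
qed

text \<open>Take a route from \<open>x\<close> to \<open>k\<close> with interior in \<open>L\<close>.  Being an induced path, it has only one
  interior vertex adjacent to \<open>k\<close>, and as \<open>d\<close> is ample this vertex has no other neighbor in \<open>T\<close>.
  If some third \<open>z\<close> in \<open>T\<close> had a neighbor on the route, then \<open>x\<close> and \<open>z\<close> would be connected
  outside the closed neighborhood of \<open>k\<close>.\<close>

lemma route_avoids:
  assumes d: "constellation d T" "ample d T"
    and L: "L \<in> components (delete_verts d T)" and x: "x \<in> T" "k \<in> T" "x \<noteq> k"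
    and S: "T \<subseteq> S"
    and sep: "\<forall>X\<subseteq>verts d. linked d X \<and> k \<notin> X \<and> (\<forall>x\<in>X. \<not> adj d k x) \<longrightarrow>
        (\<forall>s\<in>X \<inter> S. \<forall>t\<in>X \<inter> S. s = t)"
  shows "\<exists>R. route d T R x k \<and> (\<forall>z\<in>T - {x, k}. \<not> has_neighbor_in d z R)"
proof -
  have G: "simple_graph d" "stable d T" using d(1) by (auto simp: constellation_def)
  have TG: "T \<subseteq> verts d" and Tst: "\<And>s t. s \<in> T \<Longrightarrow> t \<in> T \<Longrightarrow> \<not> adj d s t"
    using G(2) by (auto simp: stable_def)
  have Ll: "linked d (verts L)" "verts L \<subseteq> verts d - T"
    using constellation_path_linked[OF d(1) L] by auto
  obtain v w where v: "v \<in> verts L" "adj d x v" and w: "w \<in> verts L" "adj d k w"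
    using d(1) L x unfolding constellation_def by blast
  let ?X = "insert x (insert k (verts L))"
  have "linked d (insert k (verts L))" using linked_insert[OF Ll(1) w(1)] w(2) by (simp add: adj_sym)
  then have lX: "linked d ?X" using linked_insert[of d _ v x] v by (simp add: adj_sym)
  have "?X \<subseteq> verts d" "?X \<inter> T = {x, k}" using Ll(2) x TG by auto
  then obtain R where R: "route d T R x k" "verts R \<subseteq> ?X"
    using route_between_exists[OF G _ lX _ x(3)] by blast
  have "induced_subgraph R d" "path_between R x k" using R(1) by (auto simp: route_def)
  then obtain X xs where X: "R = induced d X" "X \<subseteq> verts d"
    and xs: "R = path_graph xs" "xs \<noteq> []" "distinct xs" "hd xs = x" "last xs = k"
    unfolding induced_subgraph_def path_between_def by blast
  have "verts R = X" using X by (auto simp: induced_def)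
  then have Xs: "X = set xs" using xs(1) by simp
  define n where "n = length xs"
  have consec: "j = Suc i \<or> i = Suc j" if "i < n" "j < n" "adj d (xs ! i) (xs ! j)" for i j
  proof -
    have "xs ! i \<in> X" "xs ! j \<in> X" using that Xs by (auto simp: n_def)
    then have "{xs ! i, xs ! j} \<in> edges R" using that(3) X(1) by (simp add: adj_def induced_def)
    then show ?thesis using path_graph_edge_iff[OF xs(3)] that(1,2) xs(1) by (simp add: n_def)
  qed
  have x0: "xs ! 0 = x" and kn: "xs ! (n - 1) = k" and n0: "n > 0"
    using xs by (simp_all add: n_def hd_conv_nth last_conv_nth)
  have walk: "successively (adj d) xs"
  proof (subst successively_conv_nth, intro allI impI)
    fix i assume "Suc i < length xs"
    then have "{xs ! i, xs ! Suc i} \<in> edges R" using path_graph_edgeI xs(1) by blast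
    then show "adj d (xs ! i) (xs ! Suc i)" using X(1) by (simp add: adj_def induced_def)
  qed
  have "\<not> has_neighbor_in d z R" if z: "z \<in> T - {x, k}" for z
  proof
    assume "has_neighbor_in d z R"
    then obtain y where y: "y \<in> set xs" "adj d z y" using xs(1) by (auto simp: has_neighbor_in_def)
    then obtain j where j: "j < n" "y = xs ! j" by (auto simp: in_set_conv_nth n_def)
    have "y \<notin> T" using y z Tst by blast
    then have yk: "y \<noteq> k" and yd: "y \<in> verts d - T"
      using x(2) y(1) Xs X(2) by auto
    have "\<not> adj d y k"
      using ample_unique_neighbor[OF d yd, of z k] z x(2) y(2) by (auto simp: adj_sym)
    moreover have "adj d (xs ! j) k" if "Suc j = n - 1"
    proof -
      have "Suc j < length xs" using that n0 by (simp add: n_def)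
      then have "adj d (xs ! j) (xs ! Suc j)" using walk by (simp add: successively_conv_nth)
      then show ?thesis using that kn by simp
    qed
    ultimately have "Suc j \<noteq> n - 1" using j(2) by blast
    moreover have "j \<noteq> n - 1" using yk j(2) kn by blast
    ultimately have jn: "Suc (Suc j) < n" using j(1) by linarith
    \<comment> \<open>the part of the route up to \<open>y\<close>, together with \<open>z\<close>, avoids the neighborhood of \<open>k\<close>\<close>
    let ?Z = "insert z (set (take (Suc j) xs))"
    have "successively (adj d) (take (Suc j) xs)"
      using walk by (metis append_take_drop_id successively_append_iff)
    then have "linked d (set (take (Suc j) xs))" by (rule linked_walk)
    moreover have "y \<in> set (take (Suc j) xs)" using j by (simp add: n_def take_Suc_conv_app_nth)
    ultimately have lZ: "linked d ?Z" using linked_insert y(2) by (metis adj_sym)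
    have ZG: "?Z \<subseteq> verts d" using Xs X(2) z TG set_take_subset[of "Suc j" xs] by auto
    have av: "u \<noteq> k \<and> \<not> adj d k u" if u: "u \<in> set (take (Suc j) xs)" for u
    proof -
      obtain i where i: "i \<le> j" "u = xs ! i"
        using u by (auto simp: in_set_conv_nth less_Suc_eq_le)
      then have "i < n - 1" "i < n" using jn by auto
      then have "u \<noteq> k" using i kn xs(3) by (auto simp: n_def nth_eq_iff_index_eq)
      moreover have "\<not> adj d k u"
        using consec[of "n - 1" i] i kn jn n0 by auto
      ultimately show ?thesis by blast
    qed
    have "x \<in> set (take (Suc j) xs)" using x0 xs(2) by (cases xs) auto
    then have "z \<in> ?Z \<inter> S" "x \<in> ?Z \<inter> S" using z x S by auto
    moreover have "k \<notin> ?Z" "\<forall>u\<in>?Z. \<not> adj d k u" using av z x Tst by auto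
    then have "\<forall>s\<in>?Z \<inter> S. \<forall>t\<in>?Z \<inter> S. s = t" using sep[rule_format, OF ZG] lZ by blast
    ultimately show False using z by blast
  qed
  then show ?thesis using R(1) by blast
qed

text \<open>The vertices of \<open>T\<close> belong to \<open>S\<close>, since they have degree at least four.\<close>

lemma zigzagged_not_separable:
  assumes d: "constellation d T" "ample d T" "zigzagged q d T"
    and T: "card T > 2 * q + 1" "card T \<ge> 4" and l: "card (components (delete_verts d T)) \<ge> 4"
  shows "\<not> separable d S"
proof
  assume sep: "separable d S"
  let ?C = "components (delete_verts d T)"
  have G: "simple_graph d" "stable d T" using d(1) by (auto simp: constellation_def)
  have TG: "T \<subseteq> verts d" and Tst: "\<And>s t. s \<in> T \<Longrightarrow> t \<in> T \<Longrightarrow> \<not> adj d s t"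
    using G(2) by (auto simp: stable_def)
  have finT: "finite T" using T(2) by (metis card.infinite not_numeral_le_zero)
  have TS: "T \<subseteq> S"
  proof
    fix t assume t: "t \<in> T"
    show "t \<in> S"
    proof (rule ccontr)
      assume "t \<notin> S"
      then have "card {u \<in> verts d. adj d t u} \<le> 3" using separable_degree(1)[OF sep] t TG by blast
      then show False using constellation_degree[OF d(1) t] l by linarith
    qed
  qed
  moreover have "T \<noteq> {}" using T(2) by auto
  ultimately have "S \<noteq> {}" by blast
  from separable_separator[OF sep this] obtain k where k: "k \<in> S"
    and kX: "\<forall>X\<subseteq>verts d. linked d X \<and> k \<notin> X \<and> (\<forall>x\<in>X. \<not> adj d k x) \<longrightarrow>
      (\<forall>s\<in>X \<inter> S. \<forall>t\<in>X \<inter> S. s = t)"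
    by (elim bexE)
  have kG: "k \<in> verts d" using k sep by (auto simp: separable_def stable_def)
  show False
  proof (cases "k \<in> T")
    case False
    then obtain L where L: "L \<in> ?C" "k \<in> verts L"
      using component_exists[of k "delete_verts d T"] kG by auto
    have "\<not> ?C \<subseteq> {L}" using l card_mono[of "{L}" ?C] by auto
    then obtain L' where L': "L' \<in> ?C" "L' \<noteq> L" by blast
    have Ll: "linked d (verts L')" "verts L' \<subseteq> verts d - T"
      using constellation_path_linked[OF d(1) L'(1)] by auto
    have kL: "k \<notin> verts L'" using component_disjoint[OF L(1) L'(1) L(2)] L'(2) by blast
    have nL: "\<not> adj d k u" if "u \<in> verts L'" for u
    proof
      assume "adj d k u"
      then have "u \<in> verts L"
        using component_adj(1)[OF L, of u] that Ll(2) False kG by (auto simp: adj_delete)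
      then show False using component_disjoint[OF L(1) L'(1) _ that] L'(2) by blast
    qed
    \<comment> \<open>\<open>k\<close> has at most one neighbor in \<open>T\<close>, so two others remain\<close>
    let ?T = "{t \<in> T. \<not> adj d k t}"
    have uniq: "\<forall>s\<in>{t \<in> T. adj d k t}. \<forall>t\<in>{t \<in> T. adj d k t}. s = t"
      using ample_unique_neighbor[OF d(1,2), of k] False kG by simp
    have "finite {t \<in> T. adj d k t}" using finT by simp
    then have "card {t \<in> T. adj d k t} \<le> Suc 0"
      using uniq by (rule card_le_Suc0_iff_eq[THEN iffD2])
    moreover have "?T \<union> {t \<in> T. adj d k t} = T" by blast
    then have "card T \<le> card ?T + card {t \<in> T. adj d k t}"
      using card_Un_le[of ?T "{t \<in> T. adj d k t}"] by simp
    ultimately have "\<not> card ?T \<le> Suc 0" using T(2) by linarith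
    then obtain s t where st: "s \<in> ?T" "t \<in> ?T" "s \<noteq> t"
      using card_le_Suc0_iff_eq[of ?T] finT by auto
    obtain v w where v: "v \<in> verts L'" "adj d s v" and w: "w \<in> verts L'" "adj d t w"
      using d(1) L'(1) st unfolding constellation_def by blast
    let ?X = "insert s (insert t (verts L'))"
    have "linked d (insert t (verts L'))" using linked_insert[OF Ll(1) w(1)] w(2) by (simp add: adj_sym)
    then have lX: "linked d ?X" using linked_insert[of d _ v s] v by (simp add: adj_sym)
    have XG: "?X \<subseteq> verts d" using Ll(2) st TG by auto
    have "k \<notin> ?X" "\<forall>u\<in>?X. \<not> adj d k u" using kL nL st False by auto
    then have "\<forall>s\<in>?X \<inter> S. \<forall>t\<in>?X \<inter> S. s = t" using kX[rule_format, OF XG] lX by blast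
    then show False using st TS by blast
  next
    case True
    from d(3) obtain r where r: "linear_order_on T r" and z: "\<forall>x\<in>T. \<forall>y\<in>T. (x, y) \<in> r \<and> x \<noteq> y \<longrightarrow>
           (\<forall>R. route d T R x y \<longrightarrow>
              card {z \<in> T. (x, z) \<in> r \<and> x \<noteq> z \<and> (z, y) \<in> r \<and> z \<noteq> y \<and>
                           \<not> has_neighbor_in d z R} < q)"
      unfolding zigzagged_def by (elim exE conjE)
    have tr: "trans r" and anti: "antisym r" and tot: "total_on T r"
      using r by (auto simp: order_on_defs)
    obtain L where L: "L \<in> ?C" using l by (metis card.empty ex_in_conv not_numeral_le_zero)
    have "card {z \<in> T. z \<noteq> x \<and> z \<noteq> k \<and> ((x, z) \<in> r \<and> (z, k) \<in> r \<or> (k, z) \<in> r \<and> (z, x) \<in> r)} < q"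
      (is "card ?Z < q") if x: "x \<in> T" "x \<noteq> k" for x
    proof -
      from route_avoids[OF d(1,2) L x(1) True x(2) TS kX]
      obtain R where R: "route d T R x k" and no: "\<forall>z\<in>T - {x, k}. \<not> has_neighbor_in d z R"
        by (elim exE conjE)
      consider "(x, k) \<in> r" | "(k, x) \<in> r" using tot x True by (auto simp: total_on_def)
      then show ?thesis
      proof cases
        case 1
        have eq: "?Z = {z \<in> T. (x, z) \<in> r \<and> x \<noteq> z \<and> (z, k) \<in> r \<and> z \<noteq> k \<and> \<not> has_neighbor_in d z R}"
          using no 1 x(2) tr anti by (auto dest: transD antisymD)
        show ?thesis unfolding eq using z[rule_format, of x k R] x True 1 R by simp
      next
        case 2
        have eq: "?Z = {z \<in> T. (k, z) \<in> r \<and> k \<noteq> z \<and> (z, x) \<in> r \<and> z \<noteq> x \<and> \<not> has_neighbor_in d z R}"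
          using no 2 x(2) tr anti by (auto dest: transD antisymD)
        show ?thesis unfolding eq using z[rule_format, of k x R] x True 2 route_sym[OF R] by simp
      qed
    qed
    then have "card T \<le> 2 * q + 1" by (rule linear_order_card_le[OF r finT True])
    then show False using T(1) by simp
  qed
qed

theorem theorem4p1:
  fixes c :: "'a graph" and S :: "'a set"
  assumes "constellation c S" and "ample c S" and "interrupted c S"
  shows
    "(\<forall>(q::nat) (d :: 'b graph) T.
        q \<ge> 1 \<and> sized_constellation (3 * q + 6) (6 * ((q + 2) choose 3)) d T \<and>
        ample d T \<and> zigzagged q d T \<longrightarrow> \<not> contains_induced c d) \<and>
     (\<forall>H :: 'c graph. subdivision_of H (binary_tree 7) \<longrightarrow>
        \<not> contains_induced c H \<and> \<not> contains_induced c (line_graph H)) \<and>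
     (\<forall>H :: 'd graph. subdivision_of H (wall 6) \<longrightarrow>
        \<not> contains_induced c H \<and> \<not> contains_induced c (line_graph H))"
proof (intro conjI allI impI)
  fix q :: nat and d :: "'b graph" and T
  assume a: "q \<ge> 1 \<and> sized_constellation (3 * q + 6) (6 * ((q + 2) choose 3)) d T \<and>
    ample d T \<and> zigzagged q d T"
  have "(q + 2) choose 3 > 0" using a by (intro zero_less_binomial) simp
  moreover have "card (components (delete_verts d T)) = 6 * ((q + 2) choose 3)"
    using a by (simp add: sized_constellation_def)
  ultimately have "card (components (delete_verts d T)) \<ge> 4" by linarith
  then have "\<not> separable d S'" for S'
    using a by (intro zigzagged_not_separable[of d T q]) (auto simp: sized_constellation_def)
  then show "\<not> contains_induced c d" using contains_induced_separable[OF assms] by blast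
next
  fix H :: "'c graph" assume H: "subdivision_of H (binary_tree 7)"
  show "\<not> contains_induced c H" "\<not> contains_induced c (line_graph H)"
    using contains_induced_separable[OF assms, of H] contains_induced_separable[OF assms, of "line_graph H"]
      subdivision_not_separable[OF has_six_paths_binary_tree H] by blast+
next
  fix H :: "'d graph" assume H: "subdivision_of H (wall 6)"
  show "\<not> contains_induced c H" "\<not> contains_induced c (line_graph H)"
    using contains_induced_separable[OF assms, of H] contains_induced_separable[OF assms, of "line_graph H"]
      subdivision_not_separable[OF has_six_paths_wall H] by blast+
qed

end
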